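(* Let $G$ be a chordal graph. Then the multiset $\mathbf{S}(G')$ satisfies the Helly property for every induced subgraph $G'$ of $G$ if and only if $G$ is Hajós-free.
   Context: Graphs are simple, finite and undirected; a graph is chordal if it has no induced cycle of length at least four. A clique is a maximal set of pairwise adjacent vertices. A clique tree of a connected chordal graph $G$ is a tree $\mathcal{T}$ whose vertices are the cliques of $G$ such that for any two cliques $C_1,C_2$, every clique on the path from $C_1$ to $C_2$ in $\mathcal{T}$ contains $C_1\cap C_2$. Each edge of a clique tree is labeled by the intersection of its two endpoint cliques; these labels are exactly the minimal vertex separators. $\mathbf{S}(G)$ denotes the multiset of edge labels of a clique tree (taken over all connected components of $G$); it does not depend on the choice of clique tree. A family $\mathcal{F}$ of sets satisfies the Helly property if every subfamily $\mathcal{F}'\subseteq\mathcal{F}$ of pairwise intersecting sets has $\bigcap_{F\in\mathcal{F}'}F\neq\emptyset$. The Hajós graph (3-sun) has vertices $x,y,z,a,b,c$ with edges $xy,yz,xz,ax,ay,bx,bz,cy,cz$. A graph is $H$-free if it has no induced subgraph isomorphic to $H$. (In the paper this is phrased as: the hereditary class of chordal graphs whose minimal separator multiset satisfies the Helly property is exactly the class of Hajós-free chordal graphs.) *)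

theory Defs
  imports "Graph_Theory.Graph_Theory" "HOL-Library.Multiset"
begin

text \<open>
  Finite simple undirected graphs are rendered by the locale \<^locale>\<open>graph\<close>: finite symmetric
  digraphs without loops and parallel arcs. An undirected edge \<open>uv\<close> is thus a pair of opposite arcs,
  and the connected components are the strongly connected components \<^const>\<open>pre_digraph.sccs\<close>.
\<close>

definition induced_free :: "('c, 'd) pre_digraph \<Rightarrow> ('a, 'b) pre_digraph \<Rightarrow> bool" where
  "induced_free H G \<longleftrightarrow> \<not> (\<exists>G'. induced_subgraph G' G \<and> digraph_iso G' H)"

text \<open>The cycle on \<open>n\<close> vertices; only meaningful for \<open>n \<ge> 3\<close>.\<close>

definition cycle_graph :: "nat \<Rightarrow> nat pair_pre_digraph" where
  "cycle_graph n =
     mk_symmetric (with_proj \<lparr> pverts = {..<n}, parcs = {(i, Suc i mod n) | i. i < n} \<rparr>)"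

definition chordal :: "('a, 'b) pre_digraph \<Rightarrow> bool" where
  "chordal G \<longleftrightarrow> (\<forall>n\<ge>4. induced_free (with_proj (cycle_graph n)) G)"

datatype hajos_vertex = VX | VY | VZ | VA | VB | VC

definition hajos_graph :: "hajos_vertex pair_pre_digraph" where
  "hajos_graph =
     mk_symmetric (with_proj
       \<lparr> pverts = {VX, VY, VZ, VA, VB, VC},
         parcs = {(VX, VY), (VY, VZ), (VX, VZ),
                  (VA, VX), (VA, VY), (VB, VX), (VB, VZ), (VC, VY), (VC, VZ)} \<rparr>)"

definition hajos_free :: "('a, 'b) pre_digraph \<Rightarrow> bool" where
  "hajos_free G \<longleftrightarrow> induced_free (with_proj hajos_graph) G"

definition pairwise_adjacent :: "('a, 'b) pre_digraph \<Rightarrow> 'a set \<Rightarrow> bool" where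
  "pairwise_adjacent G C \<longleftrightarrow> C \<subseteq> verts G \<and> pairwise (\<lambda>u v. u \<rightarrow>\<^bsub>G\<^esub> v) C"

definition cliques :: "('a, 'b) pre_digraph \<Rightarrow> 'a set set" where
  "cliques G = {C. pairwise_adjacent G C \<and> \<not> (\<exists>D. pairwise_adjacent G D \<and> C \<subset> D)}"

text \<open>
  The constant \<^const>\<open>tree\<close> of the library does not fit here: it forbids directed cycles only, and in
  a symmetric digraph every edge yields a directed cycle of length two. In a symmetric digraph
  without parallel arcs, the cycles of length at least three are those of the undirected graph.
\<close>

definition undirected_tree :: "('a, 'b) pre_digraph \<Rightarrow> bool" where
  "undirected_tree T \<longleftrightarrow>
     graph T \<and> connected T \<and> \<not> (\<exists>p. pre_digraph.cycle T p \<and> length p \<ge> 3)"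

text \<open>Since a path between two vertices of a tree is unique, ``the path'' is any path.\<close>

definition clique_tree :: "('a, 'b) pre_digraph \<Rightarrow> 'a set pair_pre_digraph \<Rightarrow> bool" where
  "clique_tree G T \<longleftrightarrow>
     undirected_tree (with_proj T) \<and> pverts T = cliques G \<and>
     (\<forall>C\<^sub>1 \<in> cliques G. \<forall>C\<^sub>2 \<in> cliques G. \<forall>p. pre_digraph.apath (with_proj T) C\<^sub>1 p C\<^sub>2 \<longrightarrow>
        (\<forall>C \<in> set (pawalk_verts C\<^sub>1 p). C\<^sub>1 \<inter> C\<^sub>2 \<subseteq> C))"

text \<open>
  One label for each undirected edge \<open>{C, D}\<close>, namely \<open>\<Inter>{C, D} = C \<inter> D\<close>; different edges may carry the
  same label.
\<close>

definition edge_labels :: "'a set pair_pre_digraph \<Rightarrow> 'a set multiset" where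
  "edge_labels T = image_mset Inter (mset_set {{C, D} | C D. (C, D) \<in> parcs T})"

text \<open>
  The multiset of minimal separators of a chordal graph. Every connected chordal graph has a clique
  tree, and its edge labels do not depend on the clique tree chosen.
\<close>

definition separators :: "('a, 'b) pre_digraph \<Rightarrow> 'a set multiset" where
  "separators G = (\<Sum>K \<in> pre_digraph.sccs G. edge_labels (SOME T. clique_tree K T))"

text \<open>The empty subfamily is harmless, because its intersection is \<^term>\<open>UNIV\<close>.\<close>

definition helly :: "'a set multiset \<Rightarrow> bool" where
  "helly F \<longleftrightarrow>
     (\<forall>F'. F' \<subseteq># F \<longrightarrow> pairwise (\<lambda>A B. A \<inter> B \<noteq> {}) (set_mset F') \<longrightarrow> \<Inter>(set_mset F') \<noteq> {})"

end

theory Submission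
  imports Defs
begin

text \<open>
  A chordal graph has a simplicial vertex; removing it and inducting orders the maximal cliques with
  the running intersection property, and linking each clique to the earlier one that absorbs its
  intersections gives a clique tree. An edge \<open>CD\<close> of a clique tree splits the cliques into two sides
  whose members meet only inside \<open>C \<inter> D\<close>. A subfamily of pairwise intersecting labels that violates
  the Helly property contains three labels and three vertices such that each vertex misses exactly
  one of the three labels; a new vertex from the far end of each of the three tree edges completes
  them to an induced 3-sun. Conversely, in any clique tree of the 3-sun the central triangle is
  adjacent to the other three cliques, and the three labels \<open>xy\<close>, \<open>xz\<close>, \<open>yz\<close> violate the Helly property.
\<close>

section \<open>Simplicial vertices and running intersections\<close>

text \<open>The multiset \<open>separators\<close> is built from a clique tree picked by
  \<open>SOME\<close> in each component. Existence of clique trees makes this pick a genuine one,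
  and both directions then argue about an arbitrary clique tree. A single empty label would already
  violate the Helly property, so connectedness of the components has to enter: it makes every label
  nonempty. Distinct components share no vertex, so labels that meet come from the same tree.
  Because the induction deletes vertices, the combinatorial part speaks of a relation
  \<open>E\<close> on a varying set \<open>V\<close> instead of digraphs; \<open>hole_free\<close>
  accordingly lists a hole as an injective cyclic sequence of vertices.\<close>

definition hole_free :: "('v \<Rightarrow> 'v \<Rightarrow> bool) \<Rightarrow> 'v set \<Rightarrow> bool" where
  "hole_free E V \<longleftrightarrow> \<not> (\<exists>n\<ge>4. \<exists>f. inj_on f {..<n} \<and> f ` {..<n} \<subseteq> V \<and>
     (\<forall>i<n. \<forall>j<n. E (f i) (f j) \<longleftrightarrow> j = Suc i mod n \<or> i = Suc j mod n))"

lemma hole_free_subset: "hole_free E V \<Longrightarrow> W \<subseteq> V \<Longrightarrow> hole_free E W"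
  unfolding hole_free_def by (meson subset_trans)

lemma rtranclp_imp_successively:
  assumes "R\<^sup>*\<^sup>* x y"
  shows "\<exists>w. w \<noteq> [] \<and> hd w = x \<and> last w = y \<and> successively R w"
  using assms
proof (induction rule: converse_rtranclp_induct)
  case base
  show ?case by (rule exI[of _ "[y]"]) simp
next
  case (step x z)
  then obtain w where "w \<noteq> []" "hd w = z" "last w = y" "successively R w" by blast
  with step.hyps show ?case by (intro exI[of _ "x # w"]) (simp add: successively_Cons)
qed

text \<open>Jumping along a chord from \<open>w ! i\<close> to \<open>w ! j\<close> would give a
  shorter walk. A repeated vertex reduces to this: the successor of its second occurrence is
  adjacent to the first, and if there is no successor, cutting at the first occurrence already
  shortens the walk.\<close>

lemma shortest_walk_induced:
  assumes w: "w \<noteq> []" "hd w = s" "last w = t" "set w \<subseteq> X" "successively E w"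
    and min: "\<And>w'. w' \<noteq> [] \<Longrightarrow> hd w' = s \<Longrightarrow> last w' = t \<Longrightarrow> set w' \<subseteq> X \<Longrightarrow>
                successively E w' \<Longrightarrow> length w \<le> length w'"
  shows "distinct w" and "i < j \<Longrightarrow> j < length w \<Longrightarrow> E (w ! i) (w ! j) \<longleftrightarrow> j = Suc i"
proof -
  have shortcut: "j \<le> Suc i" if ij: "i < j" "j < length w" and E: "E (w ! i) (w ! j)" for i j
  proof (rule ccontr)
    assume "\<not> j \<le> Suc i"
    let ?w = "take (Suc i) w @ drop j w"
    have "length ?w < length w" using ij \<open>\<not> j \<le> Suc i\<close> by simp
    moreover have "successively E ?w"
    proof -
      have "successively E (take (Suc i) w @ drop (Suc i) w)" "successively E (take j w @ drop j w)"
        using w(5) by simp_all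
      then have "successively E (take (Suc i) w)" "successively E (drop j w)"
        unfolding successively_append_iff by blast+
      moreover have "last (take (Suc i) w) = w ! i" using ij by (simp add: take_Suc_conv_app_nth)
      moreover have "hd (drop j w) = w ! j" using ij by (simp add: hd_drop_conv_nth)
      ultimately show ?thesis using E by (simp add: successively_append_iff)
    qed
    moreover have "set ?w \<subseteq> X" using w(4) set_take_subset[of "Suc i" w] set_drop_subset[of j w] by auto
    moreover have "hd ?w = s" "last ?w = t" "?w \<noteq> []" using w ij by (auto simp: hd_append)
    ultimately show False using min[of ?w] by linarith
  qed
  show "distinct w"
    unfolding distinct_conv_nth
  proof (intro allI impI notI)
    have no: False if ij: "i < j" "j < length w" and eq: "w ! i = w ! j" for i j
    proof (cases "Suc j < length w")
      case True
      then have "E (w ! j) (w ! Suc j)" using w(5) by (simp add: successively_conv_nth)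
      then show False using shortcut[of i "Suc j"] ij eq True by simp
    next
      case False
      let ?w = "take (Suc i) w"
      have "j = length w - 1" using False ij by simp
      then have "last ?w = t" using ij eq w by (simp add: last_conv_nth take_Suc_conv_app_nth)
      moreover have "successively E ?w"
        using w(5) append_take_drop_id[of "Suc i" w] by (metis successively_append_iff)
      moreover have "set ?w \<subseteq> X" using w(4) set_take_subset[of "Suc i" w] by auto
      moreover have "hd ?w = s" "?w \<noteq> []" using w by auto
      ultimately show False using min[of ?w] ij by simp
    qed
    fix i j assume "i < length w" "j < length w" "i \<noteq> j" "w ! i = w ! j"
    then show False using no[of i j] no[of j i] by (metis linorder_neqE_nat)
  qed
  show "E (w ! i) (w ! j) \<longleftrightarrow> j = Suc i" if "i < j" "j < length w"
    using shortcut[OF that] w(5) that by (auto simp: successively_conv_nth)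
qed

text \<open>The empty set counts as connected, so \<open>simplicial_exists\<close> asks for a
  nonempty \<open>A\<close> separately.\<close>

definition connected_in :: "('v \<Rightarrow> 'v \<Rightarrow> bool) \<Rightarrow> 'v set \<Rightarrow> bool" where
  "connected_in E A \<longleftrightarrow> (\<forall>u\<in>A. \<forall>v\<in>A. (\<lambda>x y. E x y \<and> x \<in> A \<and> y \<in> A)\<^sup>*\<^sup>* u v)"

text \<open>Every vertex of the enlarged set reaches \<open>a\<close> and is reached from it, the
  new one by symmetry of \<open>E\<close>.\<close>

lemma connected_in_insert:
  assumes A: "connected_in E A" and a: "a \<in> A" "E a s" and sym: "symp E"
  shows "connected_in E (insert s A)"
proof -
  let ?R = "\<lambda>x y. E x y \<and> x \<in> insert s A \<and> y \<in> insert s A"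
  have sub: "?R\<^sup>*\<^sup>* x y" if "x \<in> A" "y \<in> A" for x y
  proof -
    have "(\<lambda>x y. E x y \<and> x \<in> A \<and> y \<in> A)\<^sup>*\<^sup>* x y" using A that by (auto simp: connected_in_def)
    then show ?thesis by (rule rtranclp_mono[THEN predicate2D, rotated]) auto
  qed
  have "?R a s" "?R s a" using a sym by (auto dest: sympD)
  then have to: "?R\<^sup>*\<^sup>* x a" "?R\<^sup>*\<^sup>* a x" if "x \<in> insert s A" for x
    using that a sub by (auto intro: r_into_rtranclp)
  then show ?thesis unfolding connected_in_def by (meson rtranclp_trans)
qed

text \<open>A shortest walk from \<open>s\<close> to \<open>t\<close> through \<open>A\<close> is induced, so \<open>b\<close> closes it to a hole unless
  \<open>s\<close> and \<open>t\<close> are adjacent.\<close>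

lemma hole_free_adjacent:
  assumes hf: "hole_free E V" and sym: "symp E" and irr: "irreflp E"
    and A: "A \<subseteq> V" "connected_in E A" and st: "s \<in> V" "t \<in> V" "s \<noteq> t"
    and a: "a1 \<in> A" "E s a1" "a2 \<in> A" "E a2 t"
    and b: "b \<in> V" "b \<notin> A" "E b s" "E b t" "\<And>x. x \<in> A \<Longrightarrow> \<not> E b x"
  shows "E s t"
proof (rule ccontr)
  assume nst: "\<not> E s t"
  let ?X = "insert s (insert t A)"
  let ?W = "\<lambda>w. w \<noteq> [] \<and> hd w = s \<and> last w = t \<and> set w \<subseteq> ?X \<and> successively E w"
  have "\<exists>w. ?W w"
  proof -
    have "(\<lambda>x y. E x y \<and> x \<in> A \<and> y \<in> A)\<^sup>*\<^sup>* a1 a2"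
      using A(2) a(1,3) unfolding connected_in_def by blast
    then have "(\<lambda>x y. E x y \<and> x \<in> ?X \<and> y \<in> ?X)\<^sup>*\<^sup>* a1 a2"
      by (rule rtranclp_mono[THEN predicate2D, rotated]) auto
    then have "(\<lambda>x y. E x y \<and> x \<in> ?X \<and> y \<in> ?X)\<^sup>*\<^sup>* s t"
      by (rule converse_rtranclp_into_rtranclp[OF _ rtranclp.rtrancl_into_rtrancl, rotated])
        (use a in simp_all)
    from rtranclp_imp_successively[OF this] obtain w where w: "w \<noteq> []" "hd w = s" "last w = t"
      "successively (\<lambda>x y. E x y \<and> x \<in> ?X \<and> y \<in> ?X) w"
      by (elim exE conjE)
    \<comment> \<open>Membership in \<open>?X\<close> is read off from the steps of the walk, so the
      last vertex needs a predecessor.\<close>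
    have len: "length w \<ge> 2" using w(1-3) st(3) by (cases w; cases "tl w") auto
    have "set w \<subseteq> ?X"
    proof
      fix x assume "x \<in> set w"
      then obtain i where i: "i < length w" "w ! i = x" by (auto simp: in_set_conv_nth)
      show "x \<in> ?X"
      proof (cases "Suc i < length w")
        case True then show ?thesis using w(4) i by (auto simp: successively_conv_nth)
      next
        case False
        then have "Suc (i - 1) = i" "i - 1 < length w" using i len by auto
        then show ?thesis using w(4) i by (metis (no_types, lifting) successively_conv_nth)
      qed
    qed
    moreover have "successively E w" using w(4) by (auto simp: successively_conv_nth)
    ultimately show ?thesis using w by blast
  qed
  then obtain w where w: "?W w" and min: "\<And>w'. ?W w' \<Longrightarrow> length w \<le> length w'"
    using ex_has_least_nat[of ?W _ length] by metis
  note ind = shortest_walk_induced[of w s t ?X E]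
  have dist: "distinct w" using ind(1) w min by blast
  have chord: "E (w ! i) (w ! j) \<longleftrightarrow> j = Suc i" if "i < j" "j < length w" for i j
    using ind(2) w min that by blast
  define m where "m = length w"
  have ends: "w ! 0 = s" "w ! (m - 1) = t" using w by (auto simp: m_def hd_conv_nth last_conv_nth)
  have "m \<noteq> 0" "m \<noteq> 1" using w st(3) ends by (auto simp: m_def)
  moreover have "m \<noteq> 2"
  proof
    assume "m = 2"
    then show False using chord[of 0 1] ends nst by (simp add: m_def)
  qed
  ultimately have m: "m \<ge> 3" by linarith
  have wV: "set w \<subseteq> V" using w A st by blast
  have Ebw: "E b (w ! i) \<longleftrightarrow> i = 0 \<or> i = m - 1" if i: "i < m" for i
  proof
    assume E: "E b (w ! i)"
    have "w ! i \<in> set w" using i by (simp add: m_def)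
    then have "w ! i \<in> ?X" using w by blast
    then have "w ! i = s \<or> w ! i = t" using b(5) E by blast
    then have "w ! i = w ! 0 \<or> w ! i = w ! (m - 1)" using ends by simp
    moreover have "0 < length w" "m - 1 < length w" "i < length w"
      using i m unfolding m_def by linarith+
    ultimately show "i = 0 \<or> i = m - 1" using dist nth_eq_iff_index_eq by blast
  next
    assume "i = 0 \<or> i = m - 1" then show "E b (w ! i)" using ends b by auto
  qed
  have bw: "b \<notin> set w" using w b irr by (auto dest: irreflpD)
  \<comment> \<open>Positions below \<open>m\<close> run along the walk and position
    \<open>m\<close> is \<open>b\<close>, so the cycle has length \<open>Suc m\<close>, which is at
    least 4.\<close>
  let ?f = "\<lambda>i. (w @ [b]) ! i"
  have adj: "E (?f i) (?f j) \<longleftrightarrow> j = Suc i mod Suc m \<or> i = Suc j mod Suc m"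
    if ij: "i < j" "j < Suc m" for i j
  proof (cases "j = m")
    case True
    then have "E (?f i) (?f j) \<longleftrightarrow> E b (w ! i)" using ij sym by (auto simp: m_def nth_append dest: sympD)
    also have "\<dots> \<longleftrightarrow> i = 0 \<or> i = m - 1" using Ebw ij True by simp
    finally show ?thesis using True ij m by auto
  next
    case False
    then have "E (?f i) (?f j) \<longleftrightarrow> j = Suc i" using ij chord[of i j] by (auto simp: m_def nth_append)
    then show ?thesis using ij False by auto
  qed
  have "distinct (w @ [b])" using dist bw by simp
  then have "inj_on ?f {..<Suc m}" by (rule inj_on_nth) (simp add: m_def)
  moreover have "?f ` {..<Suc m} \<subseteq> V"
    using wV b(1) by (auto simp: m_def nth_append)
  moreover have "\<forall>i<Suc m. \<forall>j<Suc m. E (?f i) (?f j) \<longleftrightarrow> j = Suc i mod Suc m \<or> i = Suc j mod Suc m"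
  proof (intro allI impI)
    fix i j assume ij: "i < Suc m" "j < Suc m"
    consider "i < j" | "j < i" | "i = j" by linarith
    then show "E (?f i) (?f j) \<longleftrightarrow> j = Suc i mod Suc m \<or> i = Suc j mod Suc m"
    proof cases
      case 1 then show ?thesis using adj ij by blast
    next
      case 2
      have "E (?f i) (?f j) \<longleftrightarrow> E (?f j) (?f i)" using sym by (auto dest: sympD)
      then show ?thesis using adj[OF 2] ij by blast
    next
      case 3
      have "j \<noteq> Suc j mod Suc m" using m ij by (cases "j = m") auto
      then show ?thesis using 3 irr by (auto dest: irreflpD)
    qed
  qed
  moreover have "Suc m \<ge> 4" using m by simp
  ultimately show False using hf unfolding hole_free_def by blast
qed

text \<open>Let \<open>A\<close> be a maximal connected set that does not dominate \<open>V\<close>. The boundary of \<open>A\<close> is a clique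
  that is complete to the undominated vertices \<open>B\<close>, so a vertex that is simplicial in \<open>B\<close> is
  simplicial in \<open>V\<close>.\<close>

lemma simplicial_exists:
  assumes "finite V" "V \<noteq> {}" "hole_free E V" and sym: "symp E" and irr: "irreflp E"
  shows "\<exists>v\<in>V. pairwise E {x \<in> V. E v x}"
  using assms(1-3)
proof (induction V rule: finite_psubset_induct)
  case (psubset V)
  show ?case
  proof (cases "pairwise E V")
    case True
    then show ?thesis using psubset.prems by (auto simp: pairwise_def)
  next
    case False
    then obtain u z where uz: "u \<in> V" "z \<in> V" "u \<noteq> z" "\<not> E u z" by (auto simp: pairwise_def)
    let ?N = "\<lambda>A. {z \<in> V. z \<notin> A \<and> (\<forall>x\<in>A. \<not> E x z)}"
    define F where "F = {A. A \<subseteq> V \<and> A \<noteq> {} \<and> connected_in E A \<and> ?N A \<noteq> {}}"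
    have "{u} \<in> F" using uz by (auto simp: F_def connected_in_def)
    moreover have "finite F"
      by (rule finite_subset[of _ "Pow V"]) (use psubset.hyps in \<open>auto simp: F_def\<close>)
    ultimately obtain A where AF: "A \<in> F" and max: "\<And>A'. A' \<in> F \<Longrightarrow> A \<subseteq> A' \<Longrightarrow> A' = A"
      using finite_has_maximal[of F] by blast
    have A: "A \<subseteq> V" "A \<noteq> {}" "connected_in E A" "?N A \<noteq> {}" using AF by (simp_all add: F_def)
    define B where "B = ?N A"
    \<comment> \<open>A boundary vertex \<open>s\<close> not adjacent to \<open>b\<close> could join
      \<open>A\<close>: the set stays connected and \<open>b\<close> stays undominated, against
      maximality.\<close>
    have full: "E s b" if s: "s \<in> V" "s \<notin> A" "s \<notin> B" and b: "b \<in> B" for s b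
    proof (rule ccontr)
      assume "\<not> E s b"
      obtain a where a: "a \<in> A" "E a s" using s unfolding B_def by blast
      then have "connected_in E (insert s A)" using connected_in_insert[OF A(3) _ _ sym] by simp
      moreover have "b \<noteq> s" "b \<in> ?N A" using b s by (auto simp: B_def)
      then have "b \<in> ?N (insert s A)" using \<open>\<not> E s b\<close> by auto
      ultimately have "insert s A \<in> F" using A s(1) unfolding F_def by blast
      then have "insert s A = A" by (rule max) blast
      then show False using s by blast
    qed
    have "B \<subset> V" using A by (auto simp: B_def)
    moreover have "B \<noteq> {}" using A by (simp add: B_def)
    ultimately obtain b where b: "b \<in> B" "pairwise E {x \<in> B. E b x}"
      using psubset.IH[of B] hole_free_subset[OF psubset.prems(2)] by blast
    have bV: "b \<in> V" "b \<notin> A" "\<And>x. x \<in> A \<Longrightarrow> \<not> E b x" using b sym by (auto simp: B_def dest: sympD)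
    \<comment> \<open>Neighbours of \<open>b\<close> lie in \<open>B\<close> or in the boundary of
      \<open>A\<close>. Two in \<open>B\<close> are adjacent because \<open>b\<close> is simplicial
      in \<open>B\<close>, a mixed pair by \<open>full\<close>, and two boundary vertices by
      \<open>hole_free_adjacent\<close>, with \<open>A\<close> connecting them and \<open>b\<close>
      closing the cycle.\<close>
    have "E x y" if xy: "x \<in> V" "E b x" "y \<in> V" "E b y" "x \<noteq> y" for x y
    proof -
      have nA: "x \<notin> A" "y \<notin> A" using that bV by auto
      show ?thesis
      proof (cases "x \<in> B \<or> y \<in> B")
        case True
        then consider "x \<in> B" "y \<in> B" | "x \<in> B" "y \<notin> B" | "x \<notin> B" "y \<in> B" by blast
        then show ?thesis
        proof cases
          case 1
          then show ?thesis using b(2) that by (simp add: pairwise_def)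
        next
          case 2
          then show ?thesis using full[of y x] that nA sym by (auto dest: sympD)
        next
          case 3
          then show ?thesis using full[of x y] that nA by simp
        qed
      next
        case False
        then obtain a1 a2 where "a1 \<in> A" "E a1 x" "a2 \<in> A" "E a2 y" using xy nA by (auto simp: B_def)
        then show ?thesis
          using hole_free_adjacent[OF psubset.prems(2) sym irr, of A x y a1 a2 b] A that bV sym
          by (auto dest: sympD)
      qed
    qed
    then show ?thesis using bV(1) by (intro bexI[of _ b]) (auto simp: pairwise_def)
  qed
qed

section \<open>Maximal cliques under deletion of a simplicial vertex\<close>

definition maximal_cliques :: "('v \<Rightarrow> 'v \<Rightarrow> bool) \<Rightarrow> 'v set \<Rightarrow> 'v set set" where
  "maximal_cliques E V =
     {C. C \<subseteq> V \<and> pairwise E C \<and> \<not> (\<exists>D. D \<subseteq> V \<and> pairwise E D \<and> C \<subset> D)}"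

lemma maximal_cliquesD:
  assumes "C \<in> maximal_cliques E V"
  shows "C \<subseteq> V" "pairwise E C" "\<And>D. D \<subseteq> V \<Longrightarrow> pairwise E D \<Longrightarrow> C \<subseteq> D \<Longrightarrow> D = C"
  using assms by (auto simp: maximal_cliques_def)

lemma finite_maximal_cliques: "finite V \<Longrightarrow> finite (maximal_cliques E V)"
  by (rule finite_subset[of _ "Pow V"]) (auto simp: maximal_cliques_def)

lemma maximal_clique_extends:
  assumes "finite V" "C \<subseteq> V" "pairwise E C"
  obtains D where "D \<in> maximal_cliques E V" "C \<subseteq> D"
proof -
  let ?F = "{D. D \<subseteq> V \<and> pairwise E D}"
  have "finite ?F" by (rule finite_subset[of _ "Pow V"]) (use assms in auto)
  then obtain D where "D \<in> ?F" "C \<subseteq> D" "\<forall>D'\<in>?F. D \<subseteq> D' \<longrightarrow> D = D'"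
    using finite_has_maximal2[of ?F C] assms by auto
  then show ?thesis by (intro that[of D]) (auto simp: maximal_cliques_def)
qed

text \<open>\<open>insert v N\<close> is the only maximal clique through \<open>v\<close>. A maximal
  clique of the rest stays maximal unless it lies inside \<open>N\<close>, and then it equals
  \<open>N\<close>. If \<open>N\<close> was not maximal, the set difference changes nothing.\<close>

lemma maximal_cliques_simplicial:
  assumes v: "v \<in> V" and sym: "symp E" and irr: "irreflp E"
    and N: "N = {x \<in> V. E v x}" "pairwise E N"
  shows "maximal_cliques E V = insert (insert v N) (maximal_cliques E (V - {v}) - {N})" (is "?L = ?R")
proof (intro set_eqI iffI)
  have vN: "v \<notin> N" using N irr by (auto dest: irreflpD)
  have kN: "pairwise E (insert v N)" using N sym by (auto simp: pairwise_insert dest: sympD)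
  have into: "C \<subseteq> insert v N" if "C \<subseteq> V" "pairwise E C" "v \<in> C" for C
    using that N by (auto simp: pairwise_def)
  {
    fix C assume C: "C \<in> ?L"
    note CD = maximal_cliquesD[OF C]
    show "C \<in> ?R"
    proof (cases "v \<in> C")
      case True
      then have "insert v N = C" using CD(3)[of "insert v N"] into[of C] CD kN v N by auto
      then show ?thesis by simp
    next
      case False
      have "C \<noteq> N" using CD(3)[of "insert v N"] kN v N vN by auto
      moreover have "C \<in> maximal_cliques E (V - {v})"
        using CD False unfolding maximal_cliques_def by blast
      ultimately show ?thesis by simp
    qed
  next
    fix C assume "C \<in> ?R"
    then consider "C = insert v N" | "C \<in> maximal_cliques E (V - {v})" "C \<noteq> N" by blast
    then show "C \<in> ?L"
    proof cases
      case 1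
      then show ?thesis using into kN v N unfolding maximal_cliques_def by blast
    next
      case 2
      note CD = maximal_cliquesD[OF 2(1)]
      have "\<not> C \<subset> D" if D: "D \<subseteq> V" "pairwise E D" for D
      proof
        assume "C \<subset> D"
        show False
        proof (cases "v \<in> D")
          case True
          then have "C \<subseteq> N" using into[OF D] \<open>C \<subset> D\<close> CD(1) by blast
          then show False using CD(3)[of N] N vN 2(2) by blast
        next
          case False
          then show False using CD(3)[of D] D \<open>C \<subset> D\<close> by blast
        qed
      qed
      then show ?thesis using CD unfolding maximal_cliques_def by blast
    qed
  }
qed

text \<open>Deleting a simplicial vertex \<open>v\<close> with neighbourhood \<open>N\<close> either
  shrinks one clique to \<open>N\<close> or drops one clique altogether; in both cases a ranking of
  the rest extends. The clique of least rank has no predecessor, hence the guard, and will be the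
  root of the clique tree; \<open>P\<close> will be the parent of \<open>C\<close>.\<close>

lemma running_intersection_ranking:
  assumes "finite V" "hole_free E V" and sym: "symp E" and irr: "irreflp E"
  shows "\<exists>r :: 'v set \<Rightarrow> nat. inj_on r (maximal_cliques E V) \<and>
    (\<forall>C \<in> maximal_cliques E V. (\<exists>D \<in> maximal_cliques E V. r D < r C) \<longrightarrow>
      (\<exists>P \<in> maximal_cliques E V. r P < r C \<and>
        (\<forall>D \<in> maximal_cliques E V. r D < r C \<longrightarrow> C \<inter> D \<subseteq> P)))"
  using assms(1,2)
proof (induction V rule: finite_psubset_induct)
  case (psubset V)
  show ?case
  proof (cases "V = {}")
    case True
    then have "maximal_cliques E V = {{}}" by (auto simp: maximal_cliques_def)
    then show ?thesis by simp
  next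
    case False
    obtain v where v: "v \<in> V" "pairwise E {x \<in> V. E v x}"
      using simplicial_exists[OF psubset.hyps False psubset.prems sym irr] by blast
    define N where "N = {x \<in> V. E v x}"
    define M where "M = maximal_cliques E (V - {v})"
    have vN: "v \<notin> N" using irr by (auto simp: N_def dest: irreflpD)
    have MV: "maximal_cliques E V = insert (insert v N) (M - {N})"
      using maximal_cliques_simplicial[OF v(1) sym irr N_def] v by (simp add: N_def M_def)
    have vM: "v \<notin> C" if "C \<in> M" for C using that maximal_cliquesD(1) by (fastforce simp: M_def)
    have "V - {v} \<subset> V" "hole_free E (V - {v})" using v(1) hole_free_subset[OF psubset.prems] by auto
    from psubset.IH[OF this, folded M_def] obtain r :: "'v set \<Rightarrow> nat" where r: "inj_on r M"
      "\<forall>C\<in>M. (\<exists>D\<in>M. r D < r C) \<longrightarrow> (\<exists>P\<in>M. r P < r C \<and> (\<forall>D\<in>M. r D < r C \<longrightarrow> C \<inter> D \<subseteq> P))"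
      by (elim exE conjE)
    show ?thesis
    proof (cases "N \<in> M")
      case True
      let ?M = "insert (insert v N) (M - {N})"
      \<comment> \<open>\<open>insert v N\<close> takes over the rank of \<open>N\<close>. As
        \<open>v\<close> lies in one clique only, \<open>q\<close> does not change the intersection
        of two distinct cliques, so the old parents still work.\<close>
      define q where "q C = C - {v}" for C
      have q: "inj_on q ?M" "q ` ?M = M" using vM True vN by (auto simp: q_def inj_on_def image_iff)
      have qM: "q C \<in> M" if "C \<in> ?M" for C using imageI[OF that, of q] unfolding q(2) .
      have grow: "q C \<subseteq> C" for C by (auto simp: q_def)
      have meet: "C \<inter> D \<subseteq> q C \<inter> q D" if "C \<in> ?M" "D \<in> ?M" "C \<noteq> D" for C D
        using that vM by (auto simp: q_def)
      show ?thesis unfolding MV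
      proof (intro exI[of _ "\<lambda>C. r (q C)"] conjI ballI impI)
        show "inj_on (\<lambda>C. r (q C)) ?M"
          using comp_inj_on[of q ?M r] q(1) r(1) unfolding q(2) comp_def by blast
        fix C assume C: "C \<in> ?M" and "\<exists>D\<in>?M. r (q D) < r (q C)"
        then obtain D where D: "D \<in> ?M" "r (q D) < r (q C)" by blast
        have "\<exists>P\<in>M. r P < r (q C) \<and> (\<forall>D\<in>M. r D < r (q C) \<longrightarrow> q C \<inter> D \<subseteq> P)"
          using D(2) qM[OF C] qM[OF D(1)] by (intro r(2)[rule_format] bexI[of _ "q D"])
        then obtain P where P: "P \<in> M" "r P < r (q C)"
          "\<forall>D\<in>M. r D < r (q C) \<longrightarrow> q C \<inter> D \<subseteq> P" by blast
        have "P \<in> q ` ?M" unfolding q(2) by (rule P(1))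
        then obtain P' where P': "P' \<in> ?M" "q P' = P" by (elim imageE) (rule that, simp_all)
        have "C \<inter> D \<subseteq> P'" if "D \<in> ?M" "r (q D) < r (q C)" for D
        proof -
          have "C \<inter> D \<subseteq> q C \<inter> q D" using meet[OF C that(1)] that(2) by auto
          also have "\<dots> \<subseteq> P" using P(3) that(2) qM[OF that(1)] by blast
          also have "\<dots> \<subseteq> P'" using grow P' by blast
          finally show ?thesis .
        qed
        then show "\<exists>P\<in>?M. r (q P) < r (q C) \<and> (\<forall>D\<in>?M. r (q D) < r (q C) \<longrightarrow> C \<inter> D \<subseteq> P)"
          using P' P(2) by (intro bexI[of _ P']) simp_all
      qed
    next
      case False
      \<comment> \<open>Here \<open>insert v N\<close> is an additional clique: it gets a rank
        \<open>k\<close> above all others, and any old clique that extends \<open>N\<close> serves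
        as its parent.\<close>
      let ?C = "insert v N"
      have finM: "finite M" using finite_maximal_cliques psubset.hyps by (auto simp: M_def)
      have MV': "maximal_cliques E V = insert ?C M" using MV False by simp
      have CM: "?C \<notin> M" using vM by blast
      obtain k where k: "\<And>D. D \<in> M \<Longrightarrow> r D < k"
        using finM by (metis finite_imageI finite_nat_set_iff_bounded image_eqI)
      obtain P where P: "P \<in> M" "N \<subseteq> P"
        using maximal_clique_extends[of "V - {v}" N E] psubset.hyps v vN
        by (auto simp: M_def N_def)
      have old: "(r(?C := k)) D = r D" if "D \<in> M" for D using that CM by auto
      show ?thesis unfolding MV'
      proof (intro exI[of _ "r(?C := k)"] conjI ballI impI)
        show "inj_on (r(?C := k)) (insert ?C M)"
          using r(1) k CM old by (auto simp: inj_on_def)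
        fix C assume C: "C \<in> insert ?C M" and ex: "\<exists>D\<in>insert ?C M. (r(?C := k)) D < (r(?C := k)) C"
        show "\<exists>P\<in>insert ?C M. (r(?C := k)) P < (r(?C := k)) C \<and>
          (\<forall>D\<in>insert ?C M. (r(?C := k)) D < (r(?C := k)) C \<longrightarrow> C \<inter> D \<subseteq> P)"
        proof (cases "C = ?C")
          case True
          have "?C \<inter> D \<subseteq> P" if "D \<in> M" for D using P(2) vM[OF that] by blast
          then show ?thesis using True P k old by (intro bexI[of _ P]) auto
        next
          case False
          then have CinM: "C \<in> M" using C by blast
          then obtain D where D: "D \<in> M" "r D < r C" using ex old k False
            by (metis fun_upd_same insertE less_asym')
          then have "\<exists>P\<in>M. r P < r C \<and> (\<forall>D\<in>M. r D < r C \<longrightarrow> C \<inter> D \<subseteq> P)"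
            by (intro r(2)[rule_format, OF CinM] bexI[of _ D])
          then obtain P where P: "P \<in> M" "r P < r C" "\<forall>D\<in>M. r D < r C \<longrightarrow> C \<inter> D \<subseteq> P"
            by blast
          then show ?thesis using old k CinM
            by (intro bexI[of _ P]) (auto simp: less_not_sym)
        qed
      qed
    qed
  qed
qed

section \<open>Trees given by a parent map\<close>

lemma awalk_with_proj:
  "pre_digraph.awalk (with_proj T) u p v \<longleftrightarrow> u \<in> pverts T \<and> set p \<subseteq> parcs T \<and> pcas u p v"
  by (simp add: pre_digraph.awalk_def cas_with_proj_eq)

text \<open>Passes from arc walks to vertex lists, on which the arguments about ranks are carried
  out.\<close>

lemma pcas_vertices:
  assumes "pcas u p v" "set p \<subseteq> R"
  shows "pawalk_verts u p \<noteq> [] \<and> hd (pawalk_verts u p) = u \<and> last (pawalk_verts u p) = v \<and>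
    successively (\<lambda>x y. (x, y) \<in> R) (pawalk_verts u p) \<and> length (pawalk_verts u p) = Suc (length p)"
  using assms by (induction p arbitrary: u) (auto simp: successively_Cons)

text \<open>Since \<open>q\<close> lowers the natural number \<open>r\<close>, iterating it leads to
  \<open>root\<close> and never cycles, so child-parent pairs form a tree.\<close>

locale parent_tree =
  fixes M :: "'n set" and root :: 'n and q :: "'n \<Rightarrow> 'n" and r :: "'n \<Rightarrow> nat"
  assumes fin: "finite M" and root: "root \<in> M"
    and parent_in: "x \<in> M \<Longrightarrow> x \<noteq> root \<Longrightarrow> q x \<in> M"
    and parent_less: "x \<in> M \<Longrightarrow> x \<noteq> root \<Longrightarrow> r (q x) < r x"
begin

definition T :: "'n pair_pre_digraph" where
  "T = \<lparr> pverts = M, parcs = (\<Union>x \<in> M - {root}. {(x, q x), (q x, x)}) \<rparr>"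

abbreviation adj :: "'n \<Rightarrow> 'n \<Rightarrow> bool" where
  "adj x y \<equiv> (x, y) \<in> parcs T"

lemma pverts_T [simp]: "pverts T = M"
  by (simp add: T_def)

lemma adj_iff: "adj x y \<longleftrightarrow> x \<in> M \<and> x \<noteq> root \<and> y = q x \<or> y \<in> M \<and> y \<noteq> root \<and> x = q y"
  by (auto simp: T_def)

lemma adj_sym: "adj x y \<Longrightarrow> adj y x"
  by (auto simp: adj_iff)

lemma adj_lower: "adj x y \<Longrightarrow> r y \<le> r x \<Longrightarrow> x \<in> M \<and> x \<noteq> root \<and> y = q x"
  using parent_less by (fastforce simp: adj_iff)

lemma pair_graph_T: "pair_graph T"
proof
  show "fst e \<in> pverts T" "snd e \<in> pverts T" "fst e \<noteq> snd e" if "e \<in> parcs T" for e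
    using that parent_in parent_less by (cases e; fastforce simp: adj_iff)+
  show "finite (pverts T)" using fin by simp
  show "finite (parcs T)" using fin by (auto simp: T_def)
  show "symmetric (with_proj T)" by (auto simp: symmetric_def intro: symI adj_sym)
qed

sublocale T: pair_graph T by (rule pair_graph_T)

lemma connected_T: "connected (with_proj T)"
proof -
  have up: "x \<rightarrow>\<^sup>*\<^bsub>with_proj T\<^esub> root" if "x \<in> M" for x
    using that
  proof (induction "r x" arbitrary: x rule: less_induct)
    case less
    show ?case
    proof (cases "x = root")
      case False
      then have "q x \<rightarrow>\<^sup>*\<^bsub>with_proj T\<^esub> root" "adj x (q x)"
        using less parent_in parent_less by (auto simp: adj_iff)
      then show ?thesis using T.adj_reachable_trans by blast
    qed (use root in simp)
  qed
  have "x \<rightarrow>\<^sup>*\<^bsub>with_proj T\<^esub> y" if "x \<in> M" "y \<in> M" for x y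
    using up[OF that(1)] T.symmetric_reachable'[OF up[OF that(2)]] by (rule T.reachable_trans)
  then show ?thesis
    unfolding connected_def using root T.reachable_mk_symmetricI
    by (intro strongly_connectedI) auto
qed

text \<open>Both neighbours of an inner vertex of maximal rank would be its parent.\<close>

lemma path_rank_le:
  assumes w: "distinct w" "successively adj w" and x: "x \<in> set w"
  shows "r x \<le> max (r (hd w)) (r (last w))"
proof -
  have "w \<noteq> []" using x by auto
  obtain y where y: "y \<in> set w" "\<And>z. z \<in> set w \<Longrightarrow> r z \<le> r y"
    using ex_has_greatest_nat[of "\<lambda>z. z \<in> set w" x r "Suc (Max (r ` set w))"] x
    by (metis List.finite_set Max_ge finite_imageI image_eqI le_imp_less_Suc)
  obtain i where i: "i < length w" "w ! i = y" using y by (auto simp: in_set_conv_nth)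
  have "i = 0 \<or> i = length w - 1"
  proof (rule ccontr)
    assume n: "\<not> (i = 0 \<or> i = length w - 1)"
    then have n: "0 < i" "Suc i < length w" "Suc (i - 1) = i" "i - 1 < length w" using i by auto
    have "adj y (w ! Suc i)" "adj (w ! (i - 1)) y"
      using w(2) n i by (metis successively_conv_nth)+
    then have "w ! Suc i = q y" "w ! (i - 1) = q y"
      using adj_lower adj_sym y(2) n by (meson nth_mem)+
    then show False using w(1) n by (metis n_not_Suc_n nth_eq_iff_index_eq less_SucI not_less_eq)
  qed
  then have "y = hd w \<or> y = last w" using i \<open>w \<noteq> []\<close> by (auto simp: hd_conv_nth last_conv_nth)
  then show ?thesis using y(2)[OF x] by auto
qed

text \<open>Read the list from its end of larger rank, which by \<open>path_rank_le\<close> has the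
  largest rank of the whole list. Both its neighbours on the cycle would be its parent, yet they
  differ because the length is at least 3.\<close>

lemma no_cycle:
  assumes w: "distinct w" "successively adj w" "length w \<ge> 3"
  shows "\<not> adj (last w) (hd w)"
proof
  assume close: "adj (last w) (hd w)"
  have no: False if w: "distinct w" "successively adj w" "length w \<ge> 3" "adj (last w) (hd w)"
    "r (last w) \<le> r (hd w)" for w
  proof -
    obtain x y w' where w': "w = x # y # w'" "w' \<noteq> []" using w(3)
      by (cases w; cases "tl w"; cases "tl (tl w)") auto
    have "r z \<le> r x" if "z \<in> set w" for z using path_rank_le[OF w(1,2) that] w(5) w' by auto
    moreover have "adj x y" "adj x (last w)" using w w' adj_sym by auto
    ultimately have "y = q x" "last w = q x"
      using adj_lower[of x y] adj_lower[of x "last w"] w' w(5) by auto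
    then show False using w(1) w' last_in_set[of w'] by auto
  qed
  have "successively adj (rev w)"
    using w(2) by (simp add: successively_rev) (metis (no_types, lifting) adj_sym successively_mono)
  then have "r (hd w) \<le> r (last w) \<Longrightarrow> False"
    using no[of "rev w"] w(1,3) adj_sym[OF close] by (simp add: hd_rev last_rev)
  then show False using no[OF w close] by linarith
qed

lemma undirected_tree_T: "undirected_tree (with_proj T)"
proof -
  have False if p: "T.cycle p" "length p \<ge> 3" for p
  proof -
    obtain u where u: "T.awalk u p u" "distinct (tl (pawalk_verts u p))"
      using p(1) unfolding T.cycle_def by blast
    then have "pcas u p u" "set p \<subseteq> parcs T" by (auto simp: awalk_with_proj)
    \<comment> \<open>\<open>u\<close> occurs at both ends of the vertex list; dropping the first
      occurrence leaves \<open>w\<close>, whose last vertex is \<open>u\<close> and is adjacent to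
      \<open>hd w\<close>.\<close>
    from pcas_vertices[OF this] obtain w where w: "pawalk_verts u p = u # w" "last (u # w) = u"
      "successively adj (u # w)" "length w = length p"
      by (cases "pawalk_verts u p") auto
    then have "w \<noteq> []" "successively adj w" "adj u (hd w)" using p(2) by (auto simp: successively_Cons)
    then show False using no_cycle[of w] u w p(2) by auto
  qed
  then show ?thesis
    unfolding undirected_tree_def using connected_T T.pair_graphD_graph by blast
qed

text \<open>Induction on the length. From the end of larger rank the next vertex is the parent,
  since \<open>path_rank_le\<close> bounds all ranks by that end; \<open>rip\<close> pushes the
  intersection into the parent, and a shorter path remains. Equal ranks of the ends force a single
  vertex.\<close>

lemma path_running_intersection:
  fixes f :: "'n \<Rightarrow> 'b set"
  assumes inj: "inj_on r M"
    and rip: "\<And>x y. x \<in> M \<Longrightarrow> x \<noteq> root \<Longrightarrow> y \<in> M \<Longrightarrow> r y < r x \<Longrightarrow> f x \<inter> f y \<subseteq> f (q x)"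
    and w: "distinct w" "successively adj w" "set w \<subseteq> M" "x \<in> set w"
  shows "f (hd w) \<inter> f (last w) \<subseteq> f x"
  using w
proof (induction "length w" arbitrary: w x rule: less_induct)
  case less
  \<comment> \<open>The induction hypothesis is an explicit premise so that \<open>descend\<close>
    also serves \<open>rev w\<close> in the mirrored case.\<close>
  have descend: "f (hd w) \<inter> f (last w) \<subseteq> f x"
    if w: "distinct w" "successively adj w" "set w \<subseteq> M" "x \<in> set w" "r (last w) < r (hd w)"
      and IH: "\<And>w' x. length w' < length w \<Longrightarrow> distinct w' \<Longrightarrow> successively adj w' \<Longrightarrow> set w' \<subseteq> M \<Longrightarrow>
        x \<in> set w' \<Longrightarrow> f (hd w') \<inter> f (last w') \<subseteq> f x"
    for w x
  proof -
    obtain c d w' where w': "w = c # d # w'" using w(4,5) by (cases w; cases "tl w") auto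
    have "r d \<le> r c" using path_rank_le[OF w(1,2), of d] w(5) w' by auto
    then have d: "c \<noteq> root" "d = q c" using adj_lower[of c d] w(2) w' by auto
    have "f c \<inter> f (last w) \<subseteq> f d"
    proof -
      have "last w \<in> M" "c \<in> M" using last_in_set[of w] w(3) w' by auto
      then show ?thesis using rip[of c "last w"] d w(5) w' by simp
    qed
    moreover have "f d \<inter> f (last w) \<subseteq> f y" if "y \<in> set (d # w')" for y
      using IH[of "d # w'" y] w w' that by auto
    ultimately show ?thesis using w(4) w' by fastforce
  qed
  consider "r (last w) < r (hd w)" | "r (hd w) < r (last w)" | "r (hd w) = r (last w)" by linarith
  then show ?case
  proof cases
    case 1
    then show ?thesis using descend[of w x] less by blast
  next
    case 2
    have "successively adj (rev w)"
      using less(3) by (simp add: successively_rev) (metis (no_types, lifting) adj_sym successively_mono)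
    then show ?thesis using descend[of "rev w" x] less 2 by (simp add: hd_rev last_rev Int_commute)
  next
    case 3
    have "w \<noteq> []" using less(5) by auto
    then have "hd w = last w" using inj 3 less(4) by (auto simp: inj_on_def subset_iff)
    then have "w = [hd w]" using less(2) \<open>w \<noteq> []\<close> last_in_set[of "tl w"] by (cases w) (auto split: if_splits)
    then have "x = hd w" using less(5) by (cases w) auto
    then show ?thesis by blast
  qed
qed

end

section \<open>Clique trees of chordal graphs\<close>

text \<open>\<open>P\<close> collects the cliques reached from \<open>C\<close> without using the
  edge. If \<open>D\<close> were among them, the edge would close a cycle. A path from one side to
  the other uses the edge, hence visits both \<open>C\<close> and \<open>D\<close>, and each of
  these contains \<open>A \<inter> B\<close>.\<close>

lemma clique_tree_edge_split:
  assumes ct: "clique_tree G T" and e: "(C, D) \<in> parcs T"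
  obtains P where "P \<subseteq> cliques G" "C \<in> P" "D \<in> cliques G - P"
    "\<And>A B. A \<in> P \<Longrightarrow> B \<in> cliques G - P \<Longrightarrow> A \<inter> B \<subseteq> C \<inter> D"
proof -
  have ut: "undirected_tree (with_proj T)" and V: "pverts T = cliques G"
    and through: "\<And>A B p X. A \<in> cliques G \<Longrightarrow> B \<in> cliques G \<Longrightarrow> pre_digraph.apath (with_proj T) A p B \<Longrightarrow>
      X \<in> set (pawalk_verts A p) \<Longrightarrow> A \<inter> B \<subseteq> X"
    using ct unfolding clique_tree_def by blast+
  interpret T: pair_graph T
    using ut unfolding undirected_tree_def by (intro pair_graphI_graph) blast
  define P where
    "P = {A \<in> cliques G. \<exists>p. T.awalk C p A \<and> (C, D) \<notin> set p \<and> (D, C) \<notin> set p}"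
  have CD: "C \<in> cliques G" "D \<in> cliques G" "C \<noteq> D" using e T.wellformed' T.no_loops' V by auto
  have "T.awalk C [] C" using CD V by (simp add: awalk_with_proj)
  then have "C \<in> P" using CD by (force simp: P_def)
  moreover have "D \<notin> P"
  proof
    assume "D \<in> P"
    then obtain p where p: "T.awalk C p D" "(C, D) \<notin> set p" "(D, C) \<notin> set p" by (auto simp: P_def)
    define a where "a = T.awalk_to_apath p"
    have a: "T.apath C a D" "set a \<subseteq> set p"
      unfolding a_def using T.apath_awalk_to_apath[OF p(1)] T.awalk_to_apath_subset[OF p(1)] by auto
    have "a \<noteq> []" using a CD by (auto simp: T.apath_Nil_iff)
    moreover have "a \<noteq> [x]" for x
    proof
      assume "a = [x]"
      then have "x = (C, D)" using a by (cases x) (auto simp: T.apath_simps)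
      then show False using a p \<open>a = [x]\<close> by auto
    qed
    \<comment> \<open>\<open>a\<close> has at least two arcs, since \<open>C\<close> and
      \<open>D\<close> differ and the arc \<open>(C, D)\<close> is avoided. With the arc back to
      \<open>C\<close> this meets the bound 3 in \<open>undirected_tree\<close>, which exempts the
      2-cycles of symmetric digraphs.\<close>
    ultimately have len: "length ((D, C) # a) \<ge> 3" by (cases a; cases "tl a") auto
    have "T.awalk D ((D, C) # a) D"
      using a e T.arcs_symmetric by (auto simp: T.awalk_Cons_iff T.apath_def)
    moreover have "distinct (tl (pawalk_verts D ((D, C) # a)))" using a by (simp add: T.apath_def)
    ultimately have "T.cycle ((D, C) # a)" unfolding T.cycle_def by blast
    then show False using ut len unfolding undirected_tree_def by blast
  qed
  moreover have "A \<inter> B \<subseteq> C \<inter> D" if A: "A \<in> P" and B: "B \<in> cliques G - P" for A B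
  proof -
    obtain p where p: "T.awalk C p A" "(C, D) \<notin> set p" "(D, C) \<notin> set p" "A \<in> cliques G"
      using A by (auto simp: P_def)
    have "strongly_connected (with_proj (mk_symmetric (with_proj T)))" "A \<in> pverts T" "B \<in> pverts T"
      using ut p(4) B V by (simp_all add: undirected_tree_def connected_def)
    then have "A \<rightarrow>\<^sup>*\<^bsub>with_proj (mk_symmetric (with_proj T))\<^esub> B"
      by (simp add: strongly_connected_def)
    then have "A \<rightarrow>\<^sup>*\<^bsub>with_proj T\<^esub> B" by (rule T.reachable_mk_symmetric_eq[OF T.sym_arcs, THEN iffD1])
    then obtain s where s: "T.apath A s B" unfolding T.reachable_apath by (rule exE)
    have "(C, D) \<in> set s \<or> (D, C) \<in> set s"
    proof (rule ccontr)
      assume "\<not> ?thesis"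
      moreover have "T.awalk C (p @ s) B" using p(1) s by (auto simp: T.apath_def intro: T.awalk_appendI)
      ultimately have "B \<in> P" using B p by (auto simp: P_def intro!: exI[of _ "p @ s"])
      then show False using B by blast
    qed
    then have "C \<in> set (pawalk_verts A s)" "D \<in> set (pawalk_verts A s)"
      using s T.awalk_verts_arc1[of _ s A] T.awalk_verts_arc2[of A s B] by (force simp: T.apath_def)+
    then show ?thesis using through[OF p(4) _ s] B by blast
  qed
  ultimately show ?thesis using CD by (intro that[of P]) (auto simp: P_def)
qed

section \<open>Induced subgraphs, embeddings and hereditary properties\<close>

lemma induced_subgraph_dominates:
  assumes "induced_subgraph H G"
  shows "u \<rightarrow>\<^bsub>H\<^esub> v \<longleftrightarrow> u \<in> verts H \<and> v \<in> verts H \<and> u \<rightarrow>\<^bsub>G\<^esub> v"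
proof -
  have "arcs H = {e \<in> arcs G. tail G e \<in> verts H \<and> head G e \<in> verts H}"
    and "tail H = tail G" "head H = head G"
    using assms by (auto simp: induced_subgraph_def subgraph_def compatible_def)
  then show ?thesis by (auto simp: arcs_ends_conv)
qed

lemma induced_subgraph_trans:
  "induced_subgraph F G \<Longrightarrow> induced_subgraph G H \<Longrightarrow> induced_subgraph F H"
  unfolding induced_subgraph_def subgraph_def compatible_def by auto

text \<open>An arc of a pair digraph is the pair of its ends, so the isomorphism is governed by its
  vertex part, which \<open>f\<close> inverts.\<close>

lemma induced_copy_embedding:
  assumes "induced_subgraph G' G" "digraph_iso G' (with_proj H)"
  obtains f where "inj_on f (pverts H)" "f ` pverts H = verts G'"
    "\<And>u v. u \<in> pverts H \<Longrightarrow> v \<in> pverts H \<Longrightarrow> f u \<rightarrow>\<^bsub>G\<^esub> f v \<longleftrightarrow> (u, v) \<in> parcs H"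
proof -
  obtain h where h: "pre_digraph.digraph_isomorphism G' h" "with_proj H = app_iso h G'"
    using assms(2) by (auto simp: digraph_iso_def)
  have V: "pverts H = iso_verts h ` verts G'" and A: "parcs H = iso_arcs h ` arcs G'"
    and th: "iso_tail h = fst" "iso_head h = snd"
    using arg_cong[OF h(2), of verts] arg_cong[OF h(2), of arcs]
      arg_cong[OF h(2), of tail] arg_cong[OF h(2), of head] by simp_all
  have inj: "inj_on (iso_verts h) (verts G')" and wf: "wf_digraph G'"
    and ends: "\<And>a. a \<in> arcs G' \<Longrightarrow> iso_arcs h a = (iso_verts h (tail G' a), iso_verts h (head G' a))"
    using h(1) th by (auto simp: pre_digraph.digraph_isomorphism_def prod_eq_iff)
  define f where "f = the_inv_into (verts G') (iso_verts h)"
  have f: "f (iso_verts h x) = x" if "x \<in> verts G'" for x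
    using that inj by (simp add: f_def the_inv_into_f_f)
  have "f u \<rightarrow>\<^bsub>G\<^esub> f v \<longleftrightarrow> (u, v) \<in> parcs H" if uv: "u \<in> pverts H" "v \<in> pverts H" for u v
  proof -
    obtain x y where x: "x \<in> verts G'" "u = iso_verts h x" and y: "y \<in> verts G'" "v = iso_verts h y"
      using uv V by auto
    have "(u, v) \<in> parcs H \<longleftrightarrow>
        (\<exists>a\<in>arcs G'. iso_verts h (tail G' a) = iso_verts h x \<and> iso_verts h (head G' a) = iso_verts h y)"
      using x y ends unfolding A by (auto simp: image_iff eq_commute)
    also have "\<dots> \<longleftrightarrow> (\<exists>a\<in>arcs G'. tail G' a = x \<and> head G' a = y)"
      using inj x(1) y(1) wf by (auto simp: inj_on_eq_iff wf_digraph.tail_in_verts wf_digraph.head_in_verts)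
    also have "\<dots> \<longleftrightarrow> x \<rightarrow>\<^bsub>G'\<^esub> y" by (auto simp: arcs_ends_conv)
    also have "\<dots> \<longleftrightarrow> x \<rightarrow>\<^bsub>G\<^esub> y" using induced_subgraph_dominates[OF assms(1)] x(1) y(1) by simp
    finally show ?thesis using f x y by simp
  qed
  moreover have "inj_on f (pverts H)" "f ` pverts H = verts G'"
    unfolding V using f by (auto intro!: inj_onI simp: image_iff)
  ultimately show ?thesis by (intro that[of f])
qed

text \<open>Each arc of the induced subgraph is sent to the pair of preimages of its ends; this is
  injective because \<open>G\<close> has no parallel arcs.\<close>

lemma embedding_induced_copy:
  assumes "graph G" and f: "inj_on f (pverts H)" "f ` pverts H \<subseteq> verts G"
    and wf: "parcs H \<subseteq> pverts H \<times> pverts H"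
    and E: "\<And>u v. u \<in> pverts H \<Longrightarrow> v \<in> pverts H \<Longrightarrow> f u \<rightarrow>\<^bsub>G\<^esub> f v \<longleftrightarrow> (u, v) \<in> parcs H"
  shows "\<not> induced_free (with_proj H) G"
proof -
  interpret graph G by fact
  let ?G = "G \<restriction> (f ` pverts H)"
  have ind: "induced_subgraph ?G G" using f(2) by (rule induced_induce)
  define g where "g = the_inv_into (pverts H) f"
  have g: "g (f u) = u" if "u \<in> pverts H" for u using that f by (simp add: g_def the_inv_into_f_f)
  define h where "h = \<lparr>iso_verts = g, iso_arcs = (\<lambda>a. (g (tail G a), g (head G a))),
    iso_head = snd, iso_tail = fst\<rparr>"
  have "pre_digraph.digraph_isomorphism ?G h"
    unfolding pre_digraph.digraph_isomorphism_def
  proof (intro conjI ballI)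
    show "wf_digraph ?G" using ind by (auto simp: induced_subgraph_def subgraph_def)
    show "inj_on (iso_verts h) (verts ?G)" by (auto simp: h_def g intro!: inj_onI)
    show "inj_on (iso_arcs h) (arcs ?G)"
    proof (rule inj_onI)
      fix a b assume ab: "a \<in> arcs ?G" "b \<in> arcs ?G" "iso_arcs h a = iso_arcs h b"
      then obtain u v u' v' where "tail G a = f u" "head G a = f v" "tail G b = f u'" "head G b = f v'"
        "u \<in> pverts H" "v \<in> pverts H" "u' \<in> pverts H" "v' \<in> pverts H" by auto
      with ab show "a = b" using g by (intro no_multi_arcs) (auto simp: h_def arc_to_ends_def)
    qed
  qed (auto simp: h_def)
  moreover have "with_proj H = app_iso h ?G"
  proof (rule pre_digraph.equality)
    show "verts (with_proj H) = verts (app_iso h ?G)" using g by (auto simp: h_def image_iff)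
    show "arcs (with_proj H) = arcs (app_iso h ?G)"
    proof (intro set_eqI iffI; clarsimp)
      fix u v assume uv: "(u, v) \<in> parcs H"
      then have "u \<in> pverts H" "v \<in> pverts H" using wf by auto
      moreover obtain a where "a \<in> arcs G" "tail G a = f u" "head G a = f v"
        using E uv calculation by blast
      ultimately show "(u, v) \<in> iso_arcs h ` {e \<in> arcs G. tail G e \<in> f ` pverts H \<and> head G e \<in> f ` pverts H}"
        using g by (intro image_eqI[of _ _ a]) (auto simp: h_def)
    next
      fix a u v assume a: "a \<in> arcs G" "tail G a = f u" "u \<in> pverts H" "head G a = f v" "v \<in> pverts H"
      then have "f u \<rightarrow>\<^bsub>G\<^esub> f v" using dominatesI[of a] by (simp add: arc_to_ends_def)
      then show "iso_arcs h a \<in> parcs H" using a E g by (simp add: h_def)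
    qed
  qed (auto simp: h_def)
  ultimately have "digraph_iso ?G (with_proj H)" unfolding digraph_iso_def by (intro exI conjI)
  with ind show ?thesis unfolding induced_free_def by (intro notI) (erule notE, intro exI conjI)
qed

lemma induced_free_induced_subgraph:
  assumes "induced_free H G" "induced_subgraph G' G"
  shows "induced_free H G'"
  unfolding induced_free_def
proof (intro notI, elim exE conjE)
  fix F assume "induced_subgraph F G'" "digraph_iso F H"
  then show False using assms induced_subgraph_trans[of F G' G] unfolding induced_free_def by blast
qed

lemma chordal_induced_subgraph: "chordal G \<Longrightarrow> induced_subgraph G' G \<Longrightarrow> chordal G'"
  unfolding chordal_def using induced_free_induced_subgraph by blast

lemma hajos_free_induced_subgraph: "hajos_free G \<Longrightarrow> induced_subgraph G' G \<Longrightarrow> hajos_free G'"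
  unfolding hajos_free_def by (rule induced_free_induced_subgraph)

lemma graph_induced_subgraph:
  assumes "graph G" "induced_subgraph G' G"
  shows "graph G'"
proof -
  interpret graph G by fact
  show ?thesis
    using digraphI_induced[OF assms(2)] induced_graph_imp_symmetric[OF sym_arcs assms(2)]
    by (rule digraph.graphI)
qed

lemma graph_dominates:
  assumes "graph G"
  shows "symp (dominates G)" "irreflp (dominates G)"
proof -
  interpret graph G by fact
  show "symp (dominates G)" by (intro sympI) (rule graph_symmetric)
  show "irreflp (dominates G)" by (intro irreflpI) (use adj_not_same in blast)
qed

lemma chordal_hole_free:
  assumes "graph G" "chordal G"
  shows "hole_free (dominates G) (verts G)"
  unfolding hole_free_def
proof clarify
  fix n f assume n: "4 \<le> (n::nat)" and f: "inj_on f {..<n}" "f ` {..<n} \<subseteq> verts G"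
    and E: "\<forall>i<n. \<forall>j<n. f i \<rightarrow>\<^bsub>G\<^esub> f j \<longleftrightarrow> j = Suc i mod n \<or> i = Suc j mod n"
  have V: "pverts (cycle_graph n) = {..<n}" by (simp add: cycle_graph_def)
  have A: "(u, v) \<in> parcs (cycle_graph n) \<longleftrightarrow>
      u < n \<and> v < n \<and> (v = Suc u mod n \<or> u = Suc v mod n)" for u v
    using n by (auto simp: cycle_graph_def parcs_mk_symmetric)
  have "\<not> induced_free (with_proj (cycle_graph n)) G"
    by (rule embedding_induced_copy[OF assms(1), of f]) (use f E V A in auto)
  then show False using assms(2) n by (auto simp: chordal_def)
qed

lemma cliques_eq: "cliques G = maximal_cliques (dominates G) (verts G)"
  by (auto simp: cliques_def maximal_cliques_def pairwise_adjacent_def)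

text \<open>The clique of least rank becomes the root and \<open>q\<close> picks the absorbing
  clique of the ranking, so \<open>parent_tree\<close> supplies the tree. The path condition is
  \<open>path_running_intersection\<close> with \<open>f\<close> the identity.\<close>

lemma clique_tree_exists:
  assumes "graph G" "chordal G"
  shows "\<exists>T. clique_tree G T"
proof -
  interpret graph G by fact
  let ?M = "cliques G"
  have E: "symp (dominates G)" "irreflp (dominates G)" using graph_dominates[OF assms(1)] by auto
  obtain r :: "'a set \<Rightarrow> nat" where inj: "inj_on r ?M" and
    r: "\<forall>C\<in>?M. (\<exists>D\<in>?M. r D < r C) \<longrightarrow>
      (\<exists>P\<in>?M. r P < r C \<and> (\<forall>D\<in>?M. r D < r C \<longrightarrow> C \<inter> D \<subseteq> P))"
    using running_intersection_ranking[OF finite_verts chordal_hole_free[OF assms] E]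
    unfolding cliques_eq by (elim exE conjE)
  have finM: "finite ?M" unfolding cliques_eq by (intro finite_maximal_cliques) simp
  obtain C0 where "C0 \<in> ?M"
    using maximal_clique_extends[of "verts G" "{}" "dominates G"] by (auto simp: cliques_eq)
  then obtain R where R: "R \<in> ?M" "\<And>C. C \<in> ?M \<Longrightarrow> r R \<le> r C"
    using ex_has_least_nat[of "\<lambda>C. C \<in> ?M" C0 r] by blast
  have "\<forall>C\<in>?M. C \<noteq> R \<longrightarrow> (\<exists>P\<in>?M. r P < r C \<and> (\<forall>D\<in>?M. r D < r C \<longrightarrow> C \<inter> D \<subseteq> P))"
  proof (intro ballI impI)
    fix C assume C: "C \<in> ?M" "C \<noteq> R"
    then have "r R < r C" using R inj by (metis inj_on_contraD le_neq_implies_less)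
    then show "\<exists>P\<in>?M. r P < r C \<and> (\<forall>D\<in>?M. r D < r C \<longrightarrow> C \<inter> D \<subseteq> P)"
      using R(1) by (intro r[rule_format, OF C(1)] bexI[of _ R])
  qed
  then obtain q where q: "\<And>C. C \<in> ?M \<Longrightarrow> C \<noteq> R \<Longrightarrow>
      q C \<in> ?M \<and> r (q C) < r C \<and> (\<forall>D\<in>?M. r D < r C \<longrightarrow> C \<inter> D \<subseteq> q C)"
    by metis
  interpret P: parent_tree ?M R q r
    by unfold_locales (use finM R q in auto)
  have "C1 \<inter> C2 \<subseteq> C" if p: "P.T.apath C1 p C2" and C: "C \<in> set (pawalk_verts C1 p)" for C1 C2 p C
  proof -
    have "C1 \<in> ?M" "set p \<subseteq> parcs P.T" "pcas C1 p C2" and dist: "distinct (pawalk_verts C1 p)"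
      using p by (auto simp: P.T.apath_def awalk_with_proj)
    note w = pcas_vertices[OF this(3,2)]
    have "set (pawalk_verts C1 p) \<subseteq> ?M"
      using P.T.awalk_verts_in_verts[of C1 p] p by (auto simp: P.T.apath_def)
    then show ?thesis
      using P.path_running_intersection[OF inj, of id "pawalk_verts C1 p" C] q w dist C by simp
  qed
  then have "clique_tree G P.T"
    unfolding clique_tree_def using P.undirected_tree_T by simp
  then show ?thesis by blast
qed

text \<open>With an empty label the two sides of the edge would share no vertex. Every edge of
  \<open>G\<close> lies in a clique, so a walk starting in \<open>C\<close> would stay among the
  vertices covered by its side and never reach \<open>D\<close>.\<close>

lemma label_nonempty:
  assumes "graph G" "strongly_connected G" and ct: "clique_tree G T" and e: "(C, D) \<in> parcs T"
  shows "C \<inter> D \<noteq> {}"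
proof
  assume empty: "C \<inter> D = {}"
  interpret graph G by fact
  obtain P where P: "P \<subseteq> cliques G" "C \<in> P" "D \<in> cliques G - P"
    "\<And>A B. A \<in> P \<Longrightarrow> B \<in> cliques G - P \<Longrightarrow> A \<inter> B \<subseteq> C \<inter> D"
    using clique_tree_edge_split[OF ct e] by blast
  have ext: "\<exists>A\<in>cliques G. X \<subseteq> A" if "X \<subseteq> verts G" "pairwise (dominates G) X" for X
    using maximal_clique_extends[OF finite_verts that] unfolding cliques_eq by blast
  have ne: "\<exists>x\<in>A. x \<in> verts G" if "A \<in> cliques G" for A
  proof -
    obtain v where "v \<in> verts G" using assms(2) by (auto simp: strongly_connected_def)
    then have "A \<noteq> {}"
      using maximal_cliquesD(3)[of A "dominates G" "verts G" "{v}"] that by (auto simp: cliques_eq)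
    then show ?thesis using maximal_cliquesD(1) that by (fastforce simp: cliques_eq)
  qed
  obtain x y where x: "x \<in> C" "x \<in> verts G" and y: "y \<in> D" "y \<in> verts G"
    using ne[of C] ne[of D] P(1-3) by blast
  have "x \<rightarrow>\<^sup>*\<^bsub>G\<^esub> y" using x y assms(2) by (auto simp: strongly_connected_def)
  then have "\<exists>A\<in>P. y \<in> A"
  proof (induction rule: reachable_induct)
    case base
    then show ?case using x(1) P(2) by blast
  next
    case (step u v)
    then obtain A where A: "A \<in> P" "u \<in> A" by blast
    have "{u, v} \<subseteq> verts G" using adj_in_verts[OF step(2)] by simp
    moreover have "pairwise (dominates G) {u, v}"
      using step(2) graph_symmetric by (auto simp: pairwise_insert)
    ultimately obtain B where B: "B \<in> cliques G" "{u, v} \<subseteq> B" using ext by blast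
    then have "B \<in> P" using P(4)[OF A(1), of B] A(2) empty by blast
    then show ?case using B(2) by blast
  qed
  then obtain A where "A \<in> P" "y \<in> A" by blast
  then show False using P(4)[OF _ P(3), of A] y(1) empty by blast
qed

section \<open>The induced 3-sun behind three labels\<close>

lemma pverts_hajos: "pverts hajos_graph = UNIV"
  by (auto simp: hajos_graph_def intro: hajos_vertex.exhaust)

lemma parcs_hajos: "(u, v) \<in> parcs hajos_graph \<longleftrightarrow>
  {u, v} \<in> {{VX, VY}, {VY, VZ}, {VX, VZ}, {VA, VX}, {VA, VY}, {VB, VX}, {VB, VZ}, {VC, VY}, {VC, VZ}}"
  by (cases u; cases v) (simp_all add: hajos_graph_def parcs_mk_symmetric doubleton_eq_iff)

text \<open>Name the ends of the three edges so that \<open>D\<^sub>i\<close> lies on the side \<open>Q\<^sub>i\<close> that avoids \<open>x\<^sub>i\<close>; then vertices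
  \<open>a\<^sub>i \<in> D\<^sub>i - C\<^sub>i\<close> are the outer vertices of an induced 3-sun.\<close>

lemma three_labels_not_hajos_free:
  assumes "graph G" and ct: "clique_tree G T"
    and S: "(C1, D1) \<in> parcs T" "(C2, D2) \<in> parcs T" "(C3, D3) \<in> parcs T"
    and x1: "x1 \<notin> C1 \<inter> D1" "x1 \<in> C2 \<inter> D2" "x1 \<in> C3 \<inter> D3"
    and x2: "x2 \<in> C1 \<inter> D1" "x2 \<notin> C2 \<inter> D2" "x2 \<in> C3 \<inter> D3"
    and x3: "x3 \<in> C1 \<inter> D1" "x3 \<in> C2 \<inter> D2" "x3 \<notin> C3 \<inter> D3"
  shows "\<not> hajos_free G"
proof -
  interpret graph G by fact
  have pT: "pverts T = cliques G" and gT: "pair_graph T"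
    using ct by (auto simp: clique_tree_def undirected_tree_def intro: pair_graphI_graph)
  interpret T: pair_graph T by (rule gT)
  have adj_clique: "u \<rightarrow>\<^bsub>G\<^esub> v" if "A \<in> cliques G" "u \<in> A" "v \<in> A" "u \<noteq> v" for A u v
    using maximal_cliquesD(2)[of A "dominates G" "verts G"] that by (auto simp: cliques_eq pairwise_def)
  have clique_adj: "\<exists>A\<in>cliques G. u \<in> A \<and> v \<in> A" if "u \<rightarrow>\<^bsub>G\<^esub> v" for u v
  proof -
    have "{u, v} \<subseteq> verts G" "pairwise (dominates G) {u, v}"
      using adj_in_verts[OF that] that graph_symmetric by (auto simp: pairwise_insert)
    from maximal_clique_extends[OF finite_verts this] show ?thesis by (auto simp: cliques_eq)
  qed
  \<comment> \<open>Adjacency means lying in a common clique, so the sides recorded here for the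
    cliques around \<open>x\<close> and \<open>a\<close> help to decide all adjacencies.\<close>
  define tipped where "tipped C D x a Q \<longleftrightarrow> Q \<subseteq> cliques G \<and> C \<in> cliques G - Q \<and> D \<in> Q \<and>
      (\<forall>A\<in>cliques G - Q. \<forall>B\<in>Q. A \<inter> B \<subseteq> C \<inter> D) \<and>
      (\<forall>A\<in>cliques G. x \<in> A \<longrightarrow> A \<notin> Q) \<and>
      a \<in> D \<and> (\<forall>A\<in>cliques G. a \<in> A \<longrightarrow> A \<in> Q)" for C D x a Q
  \<comment> \<open>A vertex outside the label has all its cliques on one side. The clique
    \<open>X\<close> shows which side belongs to \<open>x\<close>, and \<open>D'\<close> is taken on
    the other; \<open>a\<close> exists because distinct maximal cliques are incomparable.\<close>
  have tipped: "\<exists>C' D' a Q. {C', D'} = {C, D} \<and> tipped C' D' x a Q"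
    if e: "(C, D) \<in> parcs T" and x: "x \<notin> C \<inter> D" "(X, Y) \<in> parcs T" "x \<in> X" for C D x X Y
  proof -
    obtain P where P: "P \<subseteq> cliques G" "C \<in> P" "D \<in> cliques G - P"
      "\<And>A B. A \<in> P \<Longrightarrow> B \<in> cliques G - P \<Longrightarrow> A \<inter> B \<subseteq> C \<inter> D"
      using clique_tree_edge_split[OF ct e] by blast
    have CD: "C \<in> cliques G" "D \<in> cliques G" "C \<noteq> D" using P by auto
    have mx: "\<not> A \<subseteq> B" if "A \<in> cliques G" "B \<in> cliques G" "A \<noteq> B" for A B
      using maximal_cliquesD(3)[of A "dominates G" "verts G" B]
        maximal_cliquesD(1,2)[of B "dominates G" "verts G"] that by (auto simp: cliques_eq)
    have X: "X \<in> cliques G" using x(2) T.wellformed' pT by auto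
    show ?thesis
    proof (cases "X \<in> P")
      case True
      obtain a where a: "a \<in> D" "a \<notin> C" using mx[of D C] CD by auto
      have "A \<in> cliques G - P" if "A \<in> cliques G" "a \<in> A" for A
        using P(4)[of A D] that a P(3) by blast
      moreover have "A \<notin> cliques G - P" if "A \<in> cliques G" "x \<in> A" for A
        using P(4)[OF True, of A] x that by blast
      ultimately have "tipped C D x a (cliques G - P)"
        unfolding tipped_def using P a by (intro conjI ballI impI) blast+
      then show ?thesis by blast
    next
      case False
      obtain a where a: "a \<in> C" "a \<notin> D" using mx[of C D] CD by auto
      have "A \<in> P" if "A \<in> cliques G" "a \<in> A" for A
        using P(4)[of C A] that a P(2) by blast
      moreover have "A \<notin> P" if "A \<in> cliques G" "x \<in> A" for A
        using P(4)[of A X] False X x that by blast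
      moreover have "A \<inter> B \<subseteq> D \<inter> C" if "A \<in> cliques G - P" "B \<in> P" for A B
        using P(4)[OF that(2,1)] by blast
      ultimately have "tipped D C x a P"
        unfolding tipped_def using P(1-3) a by (intro conjI ballI impI) blast+
      moreover have "{D, C} = {C, D}" by blast
      ultimately show ?thesis by blast
    qed
  qed
  obtain C1' D1' a1 Q1 where 1: "{C1', D1'} = {C1, D1}" "tipped C1' D1' x1 a1 Q1"
    using tipped[OF S(1) x1(1) S(2) IntD1[OF x1(2)]] by (elim exE conjE)
  obtain C2' D2' a2 Q2 where 2: "{C2', D2'} = {C2, D2}" "tipped C2' D2' x2 a2 Q2"
    using tipped[OF S(2) x2(2) S(1) IntD1[OF x2(1)]] by (elim exE conjE)
  obtain C3' D3' a3 Q3 where 3: "{C3', D3'} = {C3, D3}" "tipped C3' D3' x3 a3 Q3"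
    using tipped[OF S(3) x3(3) S(1) IntD1[OF x3(1)]] by (elim exE conjE)
  have I: "C1 \<inter> D1 = C1' \<inter> D1'" "C2 \<inter> D2 = C2' \<inter> D2'" "C3 \<inter> D3 = C3' \<inter> D3'"
    using arg_cong[OF 1(1), of Inter] arg_cong[OF 2(1), of Inter] arg_cong[OF 3(1), of Inter] by simp_all
  have tD: "C \<in> cliques G" "C \<notin> Q" "D \<in> cliques G" "D \<in> Q" "a \<in> D"
    "\<And>A B. A \<in> cliques G \<Longrightarrow> A \<notin> Q \<Longrightarrow> B \<in> Q \<Longrightarrow> A \<inter> B \<subseteq> C \<inter> D"
    "\<And>A. A \<in> cliques G \<Longrightarrow> x \<in> A \<Longrightarrow> A \<notin> Q" "\<And>A. A \<in> cliques G \<Longrightarrow> a \<in> A \<Longrightarrow> A \<in> Q"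
    if "tipped C D x a Q" for C D x a Q
  proof -
    have t: "Q \<subseteq> cliques G" "C \<in> cliques G - Q" "D \<in> Q"
      "\<forall>A\<in>cliques G - Q. \<forall>B\<in>Q. A \<inter> B \<subseteq> C \<inter> D"
      "\<forall>A\<in>cliques G. x \<in> A \<longrightarrow> A \<notin> Q" "a \<in> D" "\<forall>A\<in>cliques G. a \<in> A \<longrightarrow> A \<in> Q"
      using that unfolding tipped_def by - (elim conjE, assumption)+
    show "C \<in> cliques G" "C \<notin> Q" "D \<in> cliques G" "D \<in> Q" "a \<in> D" using t(1-3,6) by blast+
    show "A \<inter> B \<subseteq> C \<inter> D" if "A \<in> cliques G" "A \<notin> Q" "B \<in> Q" for A B using t(4) that by blast
    show "A \<notin> Q" if "A \<in> cliques G" "x \<in> A" for A using t(5) that by blast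
    show "A \<in> Q" if "A \<in> cliques G" "a \<in> A" for A using t(7) that by blast
  qed
  have far: "a \<noteq> x \<and> \<not> x \<rightarrow>\<^bsub>G\<^esub> a" if "tipped C D x a Q" for C D x a Q
  proof -
    note t = tD[OF that]
    have no: False if "A \<in> cliques G" "x \<in> A" "a \<in> A" for A
      using t(7)[OF that(1,2)] t(8)[OF that(1,3)] by contradiction
    then show ?thesis using clique_adj[of x a] t(3,5) by blast
  qed
  have near: "a \<noteq> y \<and> y \<rightarrow>\<^bsub>G\<^esub> a" if "tipped C D x a Q" "y \<in> C \<inter> D" for C D x y a Q
  proof -
    note t = tD[OF that(1)]
    have "a \<notin> C" "a \<in> D" "D \<in> cliques G" using t(1,2,3,5) t(8)[of C] by blast+
    then show ?thesis using that(2) adj_clique[of D y a] by blast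
  qed
  \<comment> \<open>A common clique \<open>B\<close> of \<open>a\<close> and \<open>b\<close> lies
    in \<open>Q'\<close>, but \<open>D\<close> contains \<open>y\<close> and does not. So
    \<open>a\<close>, lying in both, belongs to \<open>C'\<close> and puts \<open>C'\<close> into
    \<open>Q\<close>, while \<open>x\<close> in \<open>C'\<close> keeps it out.\<close>
  have apart: "a \<noteq> b \<and> \<not> a \<rightarrow>\<^bsub>G\<^esub> b"
    if s: "tipped C D x a Q" and t: "tipped C' D' y b Q'" and "y \<in> C \<inter> D" "x \<in> C' \<inter> D'"
    for C D x a Q C' D' y b Q'
  proof -
    have no: False if B: "B \<in> cliques G" "a \<in> B" "b \<in> B" for B
    proof -
      have "D \<notin> Q'" using tD(3)[OF s] tD(7)[OF t] \<open>y \<in> C \<inter> D\<close> by blast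
      then have "D \<inter> B \<subseteq> C' \<inter> D'"
        using tD(3)[OF s] tD(6)[OF t] tD(8)[OF t B(1,3)] by blast
      then have "a \<in> C'" using tD(5)[OF s] B(2) by blast
      then have "C' \<in> Q" by (rule tD(8)[OF s tD(1)[OF t]])
      then show False using tD(7)[OF s tD(1)[OF t]] \<open>x \<in> C' \<inter> D'\<close> by blast
    qed
    show ?thesis using no[OF tD(3)[OF s] tD(5)[OF s]] tD(5)[OF s] no clique_adj[of a b] by blast
  qed
  have inner: "x1 \<rightarrow>\<^bsub>G\<^esub> x2" "x1 \<rightarrow>\<^bsub>G\<^esub> x3" "x2 \<rightarrow>\<^bsub>G\<^esub> x3" "x1 \<noteq> x2" "x1 \<noteq> x3" "x2 \<noteq> x3"
    using adj_clique[of C3 x1 x2] adj_clique[of C2 x1 x3] adj_clique[of C1 x2 x3]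
      S T.wellformed' pT x1 x2 x3 by auto
  have outer: "x2 \<rightarrow>\<^bsub>G\<^esub> a1" "x3 \<rightarrow>\<^bsub>G\<^esub> a1" "x1 \<rightarrow>\<^bsub>G\<^esub> a2" "x3 \<rightarrow>\<^bsub>G\<^esub> a2" "x1 \<rightarrow>\<^bsub>G\<^esub> a3" "x2 \<rightarrow>\<^bsub>G\<^esub> a3"
    "\<not> x1 \<rightarrow>\<^bsub>G\<^esub> a1" "\<not> x2 \<rightarrow>\<^bsub>G\<^esub> a2" "\<not> x3 \<rightarrow>\<^bsub>G\<^esub> a3"
    "a1 \<noteq> x1" "a1 \<noteq> x2" "a1 \<noteq> x3" "a2 \<noteq> x1" "a2 \<noteq> x2" "a2 \<noteq> x3" "a3 \<noteq> x1" "a3 \<noteq> x2" "a3 \<noteq> x3"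
    using near[OF 1(2) x2(1)[unfolded I]] near[OF 1(2) x3(1)[unfolded I]]
      near[OF 2(2) x1(2)[unfolded I]] near[OF 2(2) x3(2)[unfolded I]]
      near[OF 3(2) x1(3)[unfolded I]] near[OF 3(2) x2(3)[unfolded I]]
      far[OF 1(2)] far[OF 2(2)] far[OF 3(2)]
    by simp_all
  have stable: "a1 \<noteq> a2" "\<not> a1 \<rightarrow>\<^bsub>G\<^esub> a2" "a1 \<noteq> a3" "\<not> a1 \<rightarrow>\<^bsub>G\<^esub> a3" "a2 \<noteq> a3" "\<not> a2 \<rightarrow>\<^bsub>G\<^esub> a3"
    using apart[OF 1(2) 2(2) x2(1)[unfolded I] x1(2)[unfolded I]]
      apart[OF 1(2) 3(2) x3(1)[unfolded I] x1(3)[unfolded I]]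
      apart[OF 2(2) 3(2) x3(2)[unfolded I] x2(3)[unfolded I]] by simp_all
  have sym: "v \<rightarrow>\<^bsub>G\<^esub> u" if "u \<rightarrow>\<^bsub>G\<^esub> v" for u v using graph_symmetric that by blast
  have nsym: "\<not> v \<rightarrow>\<^bsub>G\<^esub> u" if "\<not> u \<rightarrow>\<^bsub>G\<^esub> v" for u v using graph_symmetric that by blast
  have irr: "\<not> u \<rightarrow>\<^bsub>G\<^esub> u" for u using adj_not_same by blast
  \<comment> \<open>\<open>VA\<close> is adjacent to \<open>VX\<close> and \<open>VY\<close>, so it
    must be the outer vertex that misses \<open>x3\<close>; likewise \<open>VB\<close> misses
    \<open>x2\<close> and \<open>VC\<close> misses \<open>x1\<close>.\<close>
  define f where "f = case_hajos_vertex x1 x2 x3 a3 a2 a1"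
  have "inj_on f (pverts hajos_graph)"
  proof (rule inj_onI)
    fix u v assume "f u = f v"
    then show "u = v"
      by (cases u; cases v)
        (simp_all add: f_def inner(4-6) inner(4-6)[symmetric] outer(10-18) outer(10-18)[symmetric]
          stable(1,3,5) stable(1,3,5)[symmetric])
  qed
  moreover have "f ` pverts hajos_graph \<subseteq> verts G"
  proof
    fix y assume "y \<in> f ` pverts hajos_graph"
    then obtain u where "y = f u" by blast
    then show "y \<in> verts G"
      by (cases u)
        (simp_all add: f_def adj_in_verts[OF inner(1)] adj_in_verts[OF inner(2)]
          adj_in_verts[OF outer(1)] adj_in_verts[OF outer(3)] adj_in_verts[OF outer(5)])
  qed
  moreover have "f u \<rightarrow>\<^bsub>G\<^esub> f v \<longleftrightarrow> (u, v) \<in> parcs hajos_graph" for u v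
    by (cases u; cases v)
      (simp_all add: f_def parcs_hajos doubleton_eq_iff inner(1-3) inner(1-3)[THEN sym] outer(1-9)
        outer(1-6)[THEN sym] outer(7-9)[THEN nsym] stable(2,4,6) stable(2,4,6)[THEN nsym] irr)
  ultimately show ?thesis
    unfolding hajos_free_def
    by (intro embedding_induced_copy[OF assms(1), of f hajos_graph]) (simp_all add: pverts_hajos)
qed

section \<open>The Helly property\<close>

lemma in_edge_labels:
  assumes "S \<in># edge_labels T"
  obtains C D where "(C, D) \<in> parcs T" "S = C \<inter> D"
\<comment> \<open>\<open>mset_set\<close> of an infinite set is empty, so the second case has no
  labels.\<close>
proof (cases "finite {{C, D} | C D. (C, D) \<in> parcs T}")
  case True
  with assms show ?thesis using that unfolding edge_labels_def by auto
next
  case False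
  with assms show ?thesis unfolding edge_labels_def by simp
qed

lemma edge_label_mem:
  assumes "finite (parcs T)" "(C, D) \<in> parcs T"
  shows "C \<inter> D \<in># edge_labels T"
proof -
  have eq: "{{C, D} | C D. (C, D) \<in> parcs T} = (\<lambda>(C, D). {C, D}) ` parcs T" by auto
  have "finite {{C, D} | C D. (C, D) \<in> parcs T}" unfolding eq using assms(1) by simp
  moreover have "{C, D} \<in> {{C, D} | C D. (C, D) \<in> parcs T}" using assms(2) by blast
  ultimately have "{C, D} \<in># mset_set {{C, D} | C D. (C, D) \<in> parcs T}" by (rule elem_mset_set[THEN iffD2])
  then have "\<Inter> {C, D} \<in># edge_labels T" unfolding edge_labels_def set_image_mset by (rule imageI)
  then show ?thesis by simp
qed

text \<open>Over infinitely many components the sum in \<open>separators\<close> would default to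
  the empty multiset.\<close>

lemma finite_sccs:
  assumes "graph G"
  shows "finite (pre_digraph.sccs G)"
proof -
  interpret graph G by fact
  show ?thesis unfolding sccs_conv_sccs_verts using finite_sccs_verts by simp
qed

lemma in_separators_iff:
  assumes "graph G"
  shows "S \<in># separators G \<longleftrightarrow>
    (\<exists>K \<in> pre_digraph.sccs G. S \<in># edge_labels (SOME T. clique_tree K T))"
  using finite_sccs[OF assms] by (simp add: separators_def set_mset_sum)

text \<open>Components inherit chordality, so each has a clique tree and the \<open>SOME\<close> in
  \<open>separators\<close> denotes one.\<close>

lemma scc_chordal:
  assumes "graph G" "chordal G" "K \<in> pre_digraph.sccs G"
  shows "graph K" "chordal K" "strongly_connected K" "induced_subgraph K G"
    "clique_tree K (SOME T. clique_tree K T)"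
proof -
  show K: "strongly_connected K" "induced_subgraph K G"
    using assms(3) by (auto simp: pre_digraph.sccs_def)
  then show "graph K" "chordal K"
    using assms graph_induced_subgraph chordal_induced_subgraph by blast+
  then show "clique_tree K (SOME T. clique_tree K T)"
    using clique_tree_exists by (metis someI_ex)
qed

text \<open>In a minimal subfamily with empty intersection, leaving out any member gives a common point;
  three members already suffice.\<close>

lemma not_helly_three:
  assumes fin: "finite F" and F: "\<Inter> F = {}" and ne: "{} \<notin> F"
    and pw: "pairwise (\<lambda>A B. A \<inter> B \<noteq> {}) F"
  obtains A B C x y z where "A \<in> F" "B \<in> F" "C \<in> F"
    "x \<notin> A" "x \<in> B" "x \<in> C" "y \<in> A" "y \<notin> B" "y \<in> C" "z \<in> A" "z \<in> B" "z \<notin> C"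
proof -
  define S where "S = {M. M \<subseteq> F \<and> \<Inter> M = {}}"
  have "finite S" "S \<noteq> {}" using fin F by (auto simp: S_def)
  from finite_has_minimal[OF this] obtain M where MS: "M \<in> S" "\<forall>M'\<in>S. M' \<subseteq> M \<longrightarrow> M = M'" by (elim bexE)
  then have M: "M \<subseteq> F" "\<Inter> M = {}" by (simp_all add: S_def)
  have min: "M' = M" if "M' \<subseteq> M" "\<Inter> M' = {}" for M'
  proof -
    have "M' \<in> S" using that M(1) unfolding S_def by blast
    then show ?thesis using MS(2) that(1) by blast
  qed
  have point: "\<exists>x. x \<notin> A \<and> (\<forall>B\<in>M - {A}. x \<in> B)" if "A \<in> M" for A
  proof -
    have "\<Inter> (M - {A}) \<noteq> {}" using min[of "M - {A}"] that by blast
    then obtain x where "\<forall>B\<in>M - {A}. x \<in> B" by blast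
    moreover have "x \<notin> A" using M(2) calculation by blast
    ultimately show ?thesis by blast
  qed
  \<comment> \<open>An empty \<open>M\<close> would have intersection \<open>UNIV\<close>, a
    singleton could only contain the empty set, and a pair meets by \<open>pw\<close>; hence three
    members.\<close>
  obtain A where A: "A \<in> M" using M(2) by (metis Inter_empty UNIV_not_empty ex_in_conv)
  obtain B where B: "B \<in> M" "B \<noteq> A"
    using M A ne point[OF A] by (metis (no_types, lifting) Inter_insert Inter_empty inf_top_right
        insert_absorb insert_Diff subset_iff subsetI singletonD ex_in_conv Diff_iff)
  have "\<exists>C\<in>M. C \<noteq> A \<and> C \<noteq> B"
  proof (rule ccontr)
    assume "\<not> ?thesis"
    then have "M = {A, B}" using A B by blast
    moreover have "A \<inter> B \<noteq> {}" using pw A B M(1) by (auto simp: pairwise_def)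
    ultimately show False using M(2) by simp
  qed
  then obtain C where C: "C \<in> M" "C \<noteq> A" "C \<noteq> B" by blast
  obtain x where "x \<notin> A" "\<forall>X\<in>M - {A}. x \<in> X" using point[OF A] by blast
  moreover obtain y where "y \<notin> B" "\<forall>X\<in>M - {B}. y \<in> X" using point[OF B(1)] by blast
  moreover obtain z where "z \<notin> C" "\<forall>X\<in>M - {C}. z \<in> X" using point[OF C(1)] by blast
  ultimately show ?thesis using A B C M(1) by (intro that[of A B C x y z]) auto
qed

text \<open>\<open>not_helly_three\<close> applies because labels are nonempty. The point
  \<open>z\<close> ties the component of \<open>B\<close> to that of \<open>A\<close>, and
  \<open>y\<close> that of \<open>C\<close>, so all three labels come from the clique tree of one
  component \<open>K\<close>. The resulting 3-sun is induced in \<open>G\<close> because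
  \<open>K\<close> is.\<close>

lemma hajos_free_imp_helly:
  assumes G: "graph G" "chordal G" "hajos_free G"
  shows "helly (separators G)"
  unfolding helly_def
proof (intro allI impI notI)
  fix F assume sub: "F \<subseteq># separators G"
    and pw: "pairwise (\<lambda>A B. A \<inter> B \<noteq> {}) (set_mset F)" and empty: "\<Inter> (set_mset F) = {}"
  interpret graph G by fact
  have label: "\<exists>K T C D. K \<in> sccs \<and> T = (SOME T. clique_tree K T) \<and> (C, D) \<in> parcs T \<and> S = C \<inter> D \<and>
      S \<subseteq> verts K" if S: "S \<in># F" for S
  proof -
    have "S \<in># separators G" using sub S by (meson mset_subset_eqD)
    then obtain K where K: "K \<in> sccs" "S \<in># edge_labels (SOME T. clique_tree K T)"
      unfolding in_separators_iff[OF G(1)] by blast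
    from K(2) obtain C D where CD: "(C, D) \<in> parcs (SOME T. clique_tree K T)" "S = C \<inter> D"
      by (elim in_edge_labels)
    have ct: "clique_tree K (SOME T. clique_tree K T)" using scc_chordal(5)[OF G(1,2) K(1)] .
    have "C \<in> cliques K" by (rule clique_tree_edge_split[OF ct CD(1)]) blast
    then have "S \<subseteq> verts K" using CD(2) maximal_cliquesD(1) by (fastforce simp: cliques_eq)
    then show ?thesis using K CD by blast
  qed
  have ne: "S \<noteq> {}" if "S \<in># F" for S
    using label[OF that] label_nonempty scc_chordal[OF G(1,2)] by metis
  obtain A B C x y z where S: "A \<in># F" "B \<in># F" "C \<in># F"
    and xyz: "x \<notin> A" "x \<in> B" "x \<in> C" "y \<in> A" "y \<notin> B" "y \<in> C" "z \<in> A" "z \<in> B" "z \<notin> C"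
  proof (rule not_helly_three[OF finite_set_mset empty _ pw])
    show "{} \<notin># F" using ne by blast
  qed (rule that)
  obtain K C1 D1 where 1: "K \<in> sccs" "(C1, D1) \<in> parcs (SOME T. clique_tree K T)" "A = C1 \<inter> D1" "A \<subseteq> verts K"
    using label[OF S(1)] by blast
  have same: "K' = K" if "K' \<in> sccs" "v \<in> verts K'" "v \<in> verts K" for K' v
  proof (rule ccontr)
    assume "K' \<noteq> K"
    then have "verts K' \<noteq> verts K" using that(1) 1(1) in_sccs_subset_imp_eq by blast
    then show False
      using sccs_verts_disjoint[of "verts K'" "verts K"] that 1(1) unfolding sccs_verts_conv by blast
  qed
  obtain C2 D2 where 2: "(C2, D2) \<in> parcs (SOME T. clique_tree K T)" "B = C2 \<inter> D2"
    using label[OF S(2)] same[of _ z] xyz 1(4) by blast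
  obtain C3 D3 where 3: "(C3, D3) \<in> parcs (SOME T. clique_tree K T)" "C = C3 \<inter> D3"
    using label[OF S(3)] same[of _ y] xyz 1(4) by blast
  have "\<not> hajos_free K"
    using three_labels_not_hajos_free[OF scc_chordal(1,5)[OF G(1,2) 1(1)] 1(2) 2(1) 3(1), of x y z]
      xyz 1(3) 2(2) 3(2) by blast
  then show False
    using hajos_free_induced_subgraph[OF G(3) scc_chordal(4)[OF G(1,2) 1(1)]] by blast
qed

text \<open>Every clique on the path from \<open>A\<close> to \<open>M\<close> contains \<open>A \<inter> M\<close>, so the path is a single edge.\<close>

lemma clique_tree_forced_edge:
  assumes ct: "clique_tree G T" and AM: "A \<in> cliques G" "M \<in> cliques G" "A \<noteq> M"
    and only: "\<And>C. C \<in> cliques G \<Longrightarrow> A \<inter> M \<subseteq> C \<Longrightarrow> C = A \<or> C = M"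
  shows "(A, M) \<in> parcs T"
proof -
  have ut: "undirected_tree (with_proj T)" and V: "pverts T = cliques G"
    using ct unfolding clique_tree_def by blast+
  interpret T: pair_graph T
    using ut unfolding undirected_tree_def by (intro pair_graphI_graph) blast
  have "strongly_connected (with_proj (mk_symmetric (with_proj T)))" "A \<in> pverts T" "M \<in> pverts T"
    using ut AM V by (simp_all add: undirected_tree_def connected_def)
  then have "A \<rightarrow>\<^sup>*\<^bsub>with_proj (mk_symmetric (with_proj T))\<^esub> M"
    by (simp add: strongly_connected_def)
  then have "A \<rightarrow>\<^sup>*\<^bsub>with_proj T\<^esub> M" by (rule T.reachable_mk_symmetric_eq[OF T.sym_arcs, THEN iffD1])
  then obtain p where p: "T.apath A p M" unfolding T.reachable_apath by (rule exE)
  have on: "C = A \<or> C = M" if "C \<in> set (pawalk_verts A p)" for C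
  proof -
    have "A \<inter> M \<subseteq> C" using ct p that AM unfolding clique_tree_def by blast
    moreover have "C \<in> cliques G"
      using T.awalk_verts_in_verts[of A p C] p that V by (auto simp: T.apath_def)
    ultimately show ?thesis using only by blast
  qed
  obtain e p' where p': "p = e # p'" using p AM(3) by (cases p) (auto simp: T.apath_simps)
  have e: "e \<in> parcs T" "fst e = A" "A \<noteq> snd e" using p T.no_loops[of e] by (auto simp: p' T.apath_simps)
  have "snd e \<in> set (pawalk_verts (snd e) p')" by (cases p') (use p in \<open>auto simp: p' T.apath_simps\<close>)
  then have "snd e = M" using on[of "snd e"] e p' by auto
  then show ?thesis using e by (metis prod.collapse)
qed

text \<open>Each edge of the central triangle lies in exactly two maximal cliques, the triangle and
  one outer clique, so by \<open>clique_tree_forced_edge\<close> these are adjacent in whichever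
  clique tree is chosen.\<close>

lemma separators_hajos_not_helly:
  assumes G: "graph G" "chordal G" and iso: "digraph_iso G (with_proj hajos_graph)"
  shows "\<not> helly (separators G)"
proof -
  interpret graph G by fact
  obtain f where "inj_on f (pverts hajos_graph)" "f ` pverts hajos_graph = verts G"
    "\<And>u v. u \<in> pverts hajos_graph \<Longrightarrow> v \<in> pverts hajos_graph \<Longrightarrow>
      f u \<rightarrow>\<^bsub>G\<^esub> f v \<longleftrightarrow> (u, v) \<in> parcs hajos_graph"
    by (rule induced_copy_embedding[OF induced_subgraph_refl iso], rule that, assumption+)
  then have f: "inj f" "range f = verts G"
    and E: "\<And>u v. f u \<rightarrow>\<^bsub>G\<^esub> f v \<longleftrightarrow> (u, v) \<in> parcs hajos_graph"
    by (simp_all add: pverts_hajos)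
  note parcs_hajos [simp] doubleton_eq_iff [simp]
  let ?M = "f ` {VX, VY, VZ}" and ?A = "f ` {VA, VX, VY}" and ?B = "f ` {VB, VX, VZ}"
    and ?C = "f ` {VC, VY, VZ}"
  have img: "pairwise (dominates G) (f ` X) \<longleftrightarrow> pairwise (\<lambda>u v. (u, v) \<in> parcs hajos_graph) X" for X
    using f(1) by (auto simp: pairwise_def E inj_eq)
  have max: "f ` X \<in> cliques G"
    if X: "pairwise (\<lambda>u v. (u, v) \<in> parcs hajos_graph) X"
      "\<forall>v. v \<notin> X \<longrightarrow> (\<exists>u\<in>X. (u, v) \<notin> parcs hajos_graph)" for X
  proof -
    have False if D: "D \<subseteq> verts G" "pairwise (dominates G) D" "f ` X \<subset> D" for D
    proof -
      obtain y where y: "y \<in> D" "y \<notin> f ` X" using D(3) by blast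
      have "y \<in> range f" unfolding f(2) using D(1) y(1) by (rule subsetD)
      then obtain v where v: "f v \<in> D" "v \<notin> X" using y by blast
      then obtain u where "u \<in> X" "(u, v) \<notin> parcs hajos_graph" using X(2) by blast
      then show False using D(2,3) v E f(1) by (metis imageI inj_eq pairwiseD psubsetD)
    qed
    then show ?thesis using X(1) img f(2) by (auto simp: cliques_eq maximal_cliques_def)
  qed
  have all_hajos: "(\<forall>v. P v) \<longleftrightarrow> P VX \<and> P VY \<and> P VZ \<and> P VA \<and> P VB \<and> P VC" for P
    by (metis hajos_vertex.exhaust)
  have cl: "?M \<in> cliques G" "?A \<in> cliques G" "?B \<in> cliques G" "?C \<in> cliques G"
    by (rule max; simp add: pairwise_insert all_hajos)+
  \<comment> \<open>The only possible common neighbours of \<open>p\<close> and \<open>q\<close> are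
    \<open>s\<close> and \<open>t\<close>, which are not adjacent, so a maximal clique through
    \<open>p\<close> and \<open>q\<close> contains at most one of them.\<close>
  have only: "f ` {p, q, s} = C \<or> f ` {p, q, t} = C"
    if C: "C \<in> cliques G" "f ` {p, q} \<subseteq> C" "f ` {p, q, s} \<in> cliques G" "f ` {p, q, t} \<in> cliques G"
      and common: "\<And>v. (v, p) \<in> parcs hajos_graph \<Longrightarrow> (v, q) \<in> parcs hajos_graph \<Longrightarrow> v = s \<or> v = t"
      and apart: "(s, t) \<notin> parcs hajos_graph" for C p q s t
  proof -
    note CD = maximal_cliquesD[OF C(1)[unfolded cliques_eq]]
    have in3: "x = f p \<or> x = f q \<or> x = f s \<or> x = f t" if x: "x \<in> C" for x
    proof -
      obtain v where v: "x = f v" using CD(1) f(2) x by blast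
      show ?thesis
      proof (cases "v = p \<or> v = q")
        case False
        then have "f v \<rightarrow>\<^bsub>G\<^esub> f p" "f v \<rightarrow>\<^bsub>G\<^esub> f q"
          using CD(2) v x C(2) f(1) by (auto simp: pairwise_def inj_eq)
        then show ?thesis using common[of v] v unfolding E by blast
      qed (use v in blast)
    qed
    have "\<not> (f s \<in> C \<and> f t \<in> C) \<or> s = t"
    proof -
      have "f s = f t" if "f s \<in> C" "f t \<in> C"
        using pairwiseD[OF CD(2) that] apart unfolding E by blast
      then show ?thesis using f(1) by (auto simp: inj_eq)
    qed
    then have "C \<subseteq> f ` {p, q, s} \<or> C \<subseteq> f ` {p, q, t}" using in3 by blast
    then show ?thesis
      using CD(3)[of "f ` {p, q, s}"] CD(3)[of "f ` {p, q, t}"]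
        maximal_cliquesD(1,2)[OF C(3)[unfolded cliques_eq]]
        maximal_cliquesD(1,2)[OF C(4)[unfolded cliques_eq]] by blast
  qed
  have sc: "strongly_connected G"
  proof -
    have hub: "f VX \<rightarrow>\<^sup>*\<^bsub>G\<^esub> f v" for v
    proof -
      have "f VX \<rightarrow>\<^sup>*\<^bsub>G\<^esub> f VY" "f VX \<rightarrow>\<^sup>*\<^bsub>G\<^esub> f VZ" "f VX \<rightarrow>\<^sup>*\<^bsub>G\<^esub> f VA" "f VX \<rightarrow>\<^sup>*\<^bsub>G\<^esub> f VB" "f VY \<rightarrow>\<^bsub>G\<^esub> f VC"
        by (auto simp: E)
      moreover have "f VX \<in> verts G" using f(2) by blast
      ultimately show ?thesis by (cases v) (auto intro: reachable_adj_trans)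
    qed
    show ?thesis
    proof (rule strongly_connectedI)
      fix u v assume "u \<in> verts G" "v \<in> verts G"
      then obtain u' v' where "u = f u'" "v = f v'" unfolding f(2)[symmetric] by blast
      then show "u \<rightarrow>\<^sup>*\<^bsub>G\<^esub> v" using reachable_trans[OF symmetric_reachable'[OF hub] hub] by simp
    qed (use f(2) in blast)
  qed
  \<comment> \<open>A connected graph is its own component, so the labels of its clique tree all
    enter \<open>separators\<close>.\<close>
  have GK: "G \<in> sccs"
    using sc induced_subgraph_refl by (intro in_sccsI) (auto simp: induced_subgraph_def subgraph_def)
  define T where "T = (SOME T. clique_tree G T)"
  have ct: "clique_tree G T" unfolding T_def by (rule scc_chordal(5)[OF G GK])
  then have finT: "finite (parcs T)"
    by (auto simp: clique_tree_def undirected_tree_def dest!: pair_graphI_graph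
        intro: pair_fin_digraph.pair_finite_arcs pair_graph.axioms pair_digraph.axioms)
  have AM: "?A \<inter> ?M = f ` {VX, VY}" "?B \<inter> ?M = f ` {VX, VZ}" "?C \<inter> ?M = f ` {VY, VZ}"
    using f(1) by (auto simp: inj_eq)
  have "(?A, ?M) \<in> parcs T"
  proof (rule clique_tree_forced_edge[OF ct cl(2,1)])
    show "?A \<noteq> ?M" unfolding inj_image_eq_iff[OF f(1)] by (simp add: set_eq_iff all_hajos)
    show "C = ?A \<or> C = ?M" if "C \<in> cliques G" "?A \<inter> ?M \<subseteq> C" for C
      using only[of C VX VY VA VZ] that cl unfolding AM by (auto simp: insert_commute)
  qed
  moreover have "(?B, ?M) \<in> parcs T"
  proof (rule clique_tree_forced_edge[OF ct cl(3,1)])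
    show "?B \<noteq> ?M" unfolding inj_image_eq_iff[OF f(1)] by (simp add: set_eq_iff all_hajos)
    show "C = ?B \<or> C = ?M" if "C \<in> cliques G" "?B \<inter> ?M \<subseteq> C" for C
      using only[of C VX VZ VB VY] that cl unfolding AM by (auto simp: insert_commute)
  qed
  moreover have "(?C, ?M) \<in> parcs T"
  proof (rule clique_tree_forced_edge[OF ct cl(4,1)])
    show "?C \<noteq> ?M" unfolding inj_image_eq_iff[OF f(1)] by (simp add: set_eq_iff all_hajos)
    show "C = ?C \<or> C = ?M" if "C \<in> cliques G" "?C \<inter> ?M \<subseteq> C" for C
      using only[of C VY VZ VC VX] that cl unfolding AM by (auto simp: insert_commute)
  qed
  ultimately have "f ` {VX, VY} \<in># edge_labels T" "f ` {VX, VZ} \<in># edge_labels T" "f ` {VY, VZ} \<in># edge_labels T"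
    unfolding AM[symmetric] using edge_label_mem[OF finT] by blast+
  then have S: "f ` {VX, VY} \<in># separators G" "f ` {VX, VZ} \<in># separators G" "f ` {VY, VZ} \<in># separators G"
    unfolding in_separators_iff[OF G(1)] T_def using GK by blast+
  let ?F = "{f ` {VX, VY}, f ` {VX, VZ}, f ` {VY, VZ}}"
  \<comment> \<open>Each label is needed once only, and membership in \<open>separators\<close>
    grants multiplicity at least 1.\<close>
  have "mset_set ?F \<subseteq># separators G"
    using S by (intro mset_subset_eqI) (simp add: count_mset_set' count_greater_eq_one_iff)
  moreover have "pairwise (\<lambda>A B. A \<inter> B \<noteq> {}) ?F" by (auto simp: pairwise_insert)
  moreover have "\<Inter> ?F = {}" using f(1) by (auto simp: inj_eq)
  ultimately show ?thesis unfolding helly_def by (metis finite.emptyI finite_insert finite_set_mset_mset_set)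
qed

theorem theorem2p10:
  fixes G :: "('a, 'b) pre_digraph"
  assumes "graph G" and "chordal G"
  shows "(\<forall>G'. induced_subgraph G' G \<longrightarrow> helly (separators G')) \<longleftrightarrow> hajos_free G"
proof
  assume helly: "\<forall>G'. induced_subgraph G' G \<longrightarrow> helly (separators G')"
  \<comment> \<open>An induced copy of the 3-sun is itself an induced subgraph of \<open>G\<close>
    to which the hypothesis applies.\<close>
  show "hajos_free G"
    unfolding hajos_free_def induced_free_def
    using helly separators_hajos_not_helly graph_induced_subgraph[OF assms(1)]
      chordal_induced_subgraph[OF assms(2)] by blast
next
  assume "hajos_free G"
  then show "\<forall>G'. induced_subgraph G' G \<longrightarrow> helly (separators G')"
    using hajos_free_imp_helly graph_induced_subgraph[OF assms(1)] chordal_induced_subgraph[OF assms(2)]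
      hajos_free_induced_subgraph by blast
qed

end
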